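(* Let $\alpha>-1$ and let $n\in\mathbb N$ be fixed. As $t\to+\infty$, the normalized constant $h_n(t)$ has the asymptotic expansion $$\ln h_n(t)=-2\sqrt t+\frac{2\alpha+2n+1}{4}\ln t+\widehat C(n)+\frac{(2\alpha+2n+1)(2\alpha+6n+3)}{16\sqrt t}+O(t^{-1}),$$ where the constant term $\widehat C(n)$ is $$\widehat C(n)=\frac{\ln\pi}{2}-n\ln2+\ln\Gamma(n+1),$$ and $\Gamma(\cdot)$ is the Gamma function.
   Context: For $\alpha>-1$, $t\ge0$, let $w(x;t,\alpha)=x^\alpha e^{-x-t/x}$ on $(0,\infty)$, and let $P_n(x;t,\alpha)$, $n=0,1,2,\dots$, be the monic orthogonal polynomials of degree $n$ with respect to $w$. The normalized constant is $h_n(t)=h_n(t,\alpha)=\int_0^\infty P_n^2(x;t,\alpha)w(x;t,\alpha)\,dx>0$. $\mathbb N$ denotes the positive integers. *)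

theory Defs
  imports "HOL-Analysis.Analysis" "HOL-Library.Landau_Symbols"
    "HOL-Computational_Algebra.Polynomial"
begin

definition laguerre_weight :: "real \<Rightarrow> real \<Rightarrow> real \<Rightarrow> real" where
  "laguerre_weight \<alpha> t x = x powr \<alpha> * exp (- x - t / x)"

(* For \<alpha> > -1 and t \<ge> 0 every polynomial times the weight is Lebesgue integrable
   on (0,\<infinity>), so the integrals below are never the default value 0 of a non-integrable
   function. In that range exactly one sequence P satisfies this predicate. *)
definition monic_orthogonal_polys :: "real \<Rightarrow> real \<Rightarrow> (nat \<Rightarrow> real poly) \<Rightarrow> bool" where
  "monic_orthogonal_polys \<alpha> t P \<longleftrightarrow>
     (\<forall>n. degree (P n) = n \<and> lead_coeff (P n) = 1) \<and>
     (\<forall>m n. m \<noteq> n \<longrightarrow>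
        (LINT x:{0<..}|lborel. poly (P m) x * poly (P n) x * laguerre_weight \<alpha> t x) = 0)"

definition norm_const :: "real \<Rightarrow> real \<Rightarrow> real poly \<Rightarrow> real" where
  "norm_const \<alpha> t p = (LINT x:{0<..}|lborel. (poly p x)\<^sup>2 * laguerre_weight \<alpha> t x)"

definition C_hat :: "nat \<Rightarrow> real" where
  "C_hat n = ln pi / 2 - real n * ln 2 + ln (Gamma (real n + 1))"

end

theory Submission
  imports Defs "HOL-Probability.Distributions"
begin

text \<open>
  Put \<open>t = \<sigma>\<^sup>4\<close> and substitute \<open>x = \<sigma>\<^sup>2 r(u / \<sigma>)\<^sup>2\<close>, where \<open>r(z) > 0\<close> is the solution of
  \<open>r - 1 / r = z\<close>. Then \<open>x + t / x = 2 \<sigma>\<^sup>2 + u\<^sup>2\<close>, so the weight becomes an exact Gaussian in \<open>u\<close>, and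
  the polynomials become polynomials in \<open>(x - \<sigma>\<^sup>2) / \<sigma> = u r(u / \<sigma>)\<close>. With \<open>\<epsilon> = 1 / \<sigma>\<close>, integration of
  a fixed polynomial \<open>p\<close> against the rescaled weight is
  \<open>\<integral>p (1 + \<epsilon> g\<^sub>1 + \<epsilon>\<^sup>2 g\<^sub>2 + \<epsilon>\<^sup>3 g\<^sub>3) exp (-u\<^sup>2) du + O(\<epsilon>\<^sup>4)\<close> with \<open>g\<^sub>1, g\<^sub>3\<close> odd and \<open>g\<^sub>2\<close> even.

  Let \<open>H\<^sub>n\<close> be the monic Hermite polynomial and choose \<open>q\<close> of degree below \<open>n\<close> such that \<open>g\<^sub>1 H\<^sub>n + q\<close> is
  orthogonal to all polynomials of degree below \<open>n\<close>. The trial polynomial \<open>H\<^sub>n + \<epsilon> q\<close> is then orthogonal to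
  lower degrees up to \<open>O(\<epsilon>\<^sup>2)\<close>. As the norm is minimal at the true orthogonal polynomial, the squared
  norm of the trial polynomial is already correct up to \<open>O(\<epsilon>\<^sup>4)\<close>; its \<open>\<epsilon>\<close> and \<open>\<epsilon>\<^sup>3\<close> terms vanish by parity,
  and its \<open>\<epsilon>\<^sup>2\<close> term is a finite sum of Hermite matrix elements.
\<close>

subsection \<open>The substitution\<close>

text \<open>\<open>sroot z\<close> is the positive \<open>r\<close> with \<open>r - 1 / r = z\<close>, and its derivative is \<open>r * wroot z / 2\<close>.\<close>

definition sroot :: "real \<Rightarrow> real" where
  "sroot z = z / 2 + sqrt (1 + z\<^sup>2 / 4)"

definition wroot :: "real \<Rightarrow> real" where
  "wroot z = 1 / sqrt (1 + z\<^sup>2 / 4)"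

lemma one_plus_sq_pos: "1 + z\<^sup>2 / 4 > (0::real)"
  by (simp add: add_pos_nonneg)

lemma wroot_pos: "wroot z > 0" and wroot_le_1: "wroot z \<le> 1"
  using one_plus_sq_pos[of z] by (simp_all add: wroot_def)

lemma sroot_mult_neg: "sroot z * sroot (- z) = 1"
proof -
  have "sroot z * sroot (- z) = (sqrt (1 + z\<^sup>2 / 4))\<^sup>2 - (z / 2)\<^sup>2"
    by (simp add: sroot_def algebra_simps power2_eq_square)
  then show ?thesis
    using one_plus_sq_pos[of z] by (simp add: power_divide)
qed

lemma sroot_pos: "sroot z > 0"
proof -
  have "\<bar>z / 2\<bar> < sqrt (1 + z\<^sup>2 / 4)"
    by (rule real_less_rsqrt) (simp add: power_divide)
  then show ?thesis by (simp add: sroot_def)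
qed

lemma sroot_minus: "sroot (- z) = 1 / sroot z"
  using sroot_mult_neg[of z] sroot_pos[of z] by (simp add: field_simps)

lemma sroot_diff_inverse: "sroot z - 1 / sroot z = z"
  unfolding sroot_minus[symmetric] by (simp add: sroot_def)

lemma sroot_le: "sroot z \<le> 2 * (1 + z\<^sup>2)"
proof -
  have "1 + z\<^sup>2 / 4 \<le> (1 + z\<^sup>2 / 4)\<^sup>2"
    using one_plus_sq_pos[of z] by (simp add: power2_eq_square)
  then have 1: "sqrt (1 + z\<^sup>2 / 4) \<le> 1 + z\<^sup>2 / 4"
    using one_plus_sq_pos[of z] by (intro real_le_lsqrt) auto
  have "0 \<le> (z - 1)\<^sup>2" by simp
  then have "2 * z \<le> 1 + z\<^sup>2"
    by (simp add: power2_eq_square algebra_simps)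
  moreover have "0 \<le> z\<^sup>2" by simp
  ultimately have "z / 2 + (1 + z\<^sup>2 / 4) \<le> 2 * (1 + z\<^sup>2)"
    unfolding distrib_left by linarith
  then show ?thesis using 1 unfolding sroot_def by (meson add_left_mono order_trans)
qed

text \<open>The exponent may have either sign: \<open>sroot z\<close> and its reciprocal
  \<open>sroot (- z)\<close> are both at most 2 (1 + z^2), which bounds the absolute value of ln
  (\<open>sroot z\<close>). One exponent serves all z, so Taylor remainders grow only polynomially
  and stay integrable against the Gaussian.\<close>

lemma sroot_powr_le:
  obtains N :: nat where "\<And>z. sroot z powr b \<le> (2 * (1 + z\<^sup>2)) ^ N"
proof
  fix z :: real
  define N where "N = nat \<lceil>\<bar>b\<bar>\<rceil>"
  define m where "m = 2 * (1 + z\<^sup>2)"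
  have m: "m \<ge> 1" "sroot z \<le> m" "1 / m \<le> sroot z"
    using sroot_le[of z] sroot_le[of "- z"] sroot_pos[of z]
    by (simp_all add: m_def sroot_minus field_simps)
  have "\<bar>ln (sroot z)\<bar> \<le> ln m"
    using m sroot_pos[of z] ln_mono[of "sroot z" m] ln_mono[of "1 / m" "sroot z"]
    by (simp add: ln_div abs_le_iff)
  then have "\<bar>b * ln (sroot z)\<bar> \<le> \<bar>b\<bar> * ln m"
    by (simp add: abs_mult mult_left_mono)
  also have "\<dots> \<le> real N * ln m"
    using m(1) by (intro mult_right_mono) (auto simp: N_def real_nat_ceiling_ge)
  finally have "b * ln (sroot z) \<le> real N * ln m" by linarith
  then have "sroot z powr b \<le> m powr real N"
    using m(1) sroot_pos[of z] by (simp add: powr_def)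
  also have "\<dots> = m ^ N"
    using m(1) by (simp add: powr_realpow)
  finally show "sroot z powr b \<le> (2 * (1 + z\<^sup>2)) ^ nat \<lceil>\<bar>b\<bar>\<rceil>"
    by (simp add: m_def N_def)
qed

lemma has_real_derivative_sqrt_one_plus_sq:
  "((\<lambda>z. sqrt (1 + z\<^sup>2 / 4)) has_real_derivative z / 4 * wroot z) (at z)"
proof -
  have "((\<lambda>z. 1 + z\<^sup>2 / 4) has_real_derivative z / 2) (at z)"
    by (rule derivative_eq_intros refl | simp)+
  then have "((\<lambda>z. sqrt (1 + z\<^sup>2 / 4)) has_real_derivative
      inverse (sqrt (1 + z\<^sup>2 / 4)) / 2 * (z / 2)) (at z)"
    by (rule DERIV_chain2[where f = sqrt and g = "\<lambda>z. 1 + z\<^sup>2 / 4", OF DERIV_real_sqrt[OF one_plus_sq_pos]])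
  then show ?thesis
    by (simp add: wroot_def inverse_eq_divide mult.commute)
qed

lemma has_real_derivative_wroot:
  "(wroot has_real_derivative - (z / 4) * wroot z ^ 3) (at z)"
proof -
  have "(\<lambda>z. inverse (sqrt (1 + z\<^sup>2 / 4))) = wroot"
    by (simp add: fun_eq_iff wroot_def inverse_eq_divide)
  note * = DERIV_inverse'[OF has_real_derivative_sqrt_one_plus_sq, of z, unfolded this]
  have "inverse (sqrt (1 + z\<^sup>2 / 4)) = wroot z"
    by (simp add: wroot_def inverse_eq_divide)
  with * one_plus_sq_pos[of z] show ?thesis
    by (simp add: power3_eq_cube mult.assoc mult.left_commute)
qed

lemma has_real_derivative_sroot:
  "(sroot has_real_derivative sroot z * wroot z / 2) (at z)"
proof -
  have "((\<lambda>z. z / 2 + sqrt (1 + z\<^sup>2 / 4)) has_real_derivative 1 / 2 + z / 4 * wroot z) (at z)"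
    by (intro DERIV_add has_real_derivative_sqrt_one_plus_sq DERIV_cdivide DERIV_ident)
  moreover have "1 / 2 + z / 4 * wroot z = sroot z * wroot z / 2"
  proof -
    have "1 / 2 + z / 4 * (1 / s) = (z / 2 + s) * (1 / s) / 2" if "s \<noteq> 0" for s
      using that by (simp add: field_simps)
    then show ?thesis
      using one_plus_sq_pos[of z] unfolding sroot_def wroot_def by (metis less_irrefl real_sqrt_eq_zero_cancel_iff)
  qed
  ultimately show ?thesis
    unfolding sroot_def [abs_def] by (rule DERIV_cong)
qed

section \<open>Taylor expansion of \<open>wroot z * sroot z powr b\<close> at 0\<close>

lemma has_real_derivative_sroot_powr:
  "((\<lambda>z. sroot z powr b) has_real_derivative b / 2 * wroot z * sroot z powr b) (at z)"
proof -
  have "sroot z * sroot z powr (b - 1) = sroot z powr b"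
    using sroot_pos[of z] by (simp add: powr_mult_base)
  then have "b * sroot z powr (b - 1) * (sroot z * wroot z / 2) = b / 2 * wroot z * sroot z powr b"
    by (simp add: mult.commute)
  with DERIV_chain2[where g = sroot and x = z, OF has_real_derivative_powr[OF sroot_pos] has_real_derivative_sroot]
  show ?thesis by (rule DERIV_cong)
qed

text \<open>For fixed b these functions span a space closed under differentiation, which reduces
  higher derivatives to bookkeeping of coefficients. The truncated \<open>i - 1\<close> is harmless
  because its term carries the factor i.\<close>

lemma has_real_derivative_monomial:
  "((\<lambda>z. z ^ i * wroot z ^ j * sroot z powr b) has_real_derivative
    (real i * z ^ (i - 1) * wroot z ^ j - real j / 4 * z ^ (i + 1) * wroot z ^ (j + 2)
     + b / 2 * z ^ i * wroot z ^ (j + 1)) * sroot z powr b) (at z)"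
proof -
  have *: "((\<lambda>z. wroot z ^ j) has_real_derivative - (real j / 4) * z * wroot z ^ (j + 2)) (at z)"
    by (rule DERIV_cong[OF DERIV_power[OF has_real_derivative_wroot]])
      (cases j; simp add: power3_eq_cube)
  show ?thesis
    by (rule derivative_eq_intros * has_real_derivative_sroot_powr refl)+
      (simp add: algebra_simps)
qed

text \<open>Taylor's formula of order four. The fourth derivative is a combination of terms with i
  \<le> 4, hence polynomially bounded by \<open>sroot_powr_le\<close>. The factor
  \<open>wroot z\<close> is there because the Jacobian of the substitution contributes it.\<close>

lemma sroot_powr_Maclaurin:
  obtains K :: real and N :: nat where
    "\<And>z. \<bar>wroot z * sroot z powr b
        - (1 + b / 2 * z + (b\<^sup>2 - 1) / 8 * z\<^sup>2 + (b ^ 3 / 48 - b / 12) * z ^ 3)\<bar>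
      \<le> K * z ^ 4 * (1 + z\<^sup>2) ^ N"
proof -
  obtain N where N: "\<And>z. sroot z powr b \<le> (2 * (1 + z\<^sup>2)) ^ N"
    using sroot_powr_le by blast
  define m where "m i j z = z ^ i * wroot z ^ j * sroot z powr b" for z :: real and i j :: nat
  define M where "M c i j z = c * m i j z" for c z :: real and i j :: nat
  have DM: "(M c i j has_real_derivative
      M (real i * c) (i - 1) j z + M (- (real j / 4 * c)) (i + 1) (j + 2) z + M (b / 2 * c) i (j + 1) z) (at z)"
    for c i j z
    unfolding M_def m_def [abs_def]
    by (rule DERIV_cong, rule DERIV_cmult, rule has_real_derivative_monomial) (simp add: algebra_simps)
  \<comment> \<open>\<open>c0\<close> to \<open>c3\<close> are the coefficients of the third
    derivative \<open>f3\<close>; at z = 0 only the term with \<open>c0\<close> survives, as the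
    others carry a power of z.\<close>
  define c0 where "c0 = b * (b\<^sup>2 - 1) / 8 - 3 * b / 8"
  define c1 where "c1 = - (3 * (b\<^sup>2 - 1) / 16) - 3 * b\<^sup>2 / 16 + 3 / 8"
  define c2 where "c2 = 15 * b / 32"
  define c3 where "c3 = - (15 / 64 :: real)"
  define f0 where "f0 = M 1 0 1"
  define f1 where "f1 = (\<lambda>z. M (b / 2) 0 2 z + M (- (1 / 4)) 1 3 z)"
  define f2 where "f2 = (\<lambda>z. M ((b\<^sup>2 - 1) / 4) 0 3 z + M (- (3 * b / 8)) 1 4 z + M (3 / 16) 2 5 z)"
  define f3 where "f3 = (\<lambda>z. M c0 0 4 z + M c1 1 5 z + M c2 2 6 z + M c3 3 7 z)"
  define f4 where "f4 = (\<lambda>z. M (- c0) 1 6 z + M (b / 2 * c0) 0 5 z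
    + M c1 0 5 z + M (- (5 / 4 * c1)) 2 7 z + M (b / 2 * c1) 1 6 z
    + M (2 * c2) 1 6 z + M (- (6 / 4 * c2)) 3 8 z + M (b / 2 * c2) 2 7 z
    + M (3 * c3) 2 7 z + M (- (7 / 4 * c3)) 4 9 z + M (b / 2 * c3) 3 8 z)"
  have D0: "(f0 has_real_derivative f1 z) (at z)" for z
    unfolding f0_def f1_def by (rule DERIV_cong, rule DM) (simp add: M_def eval_nat_numeral)
  have D1: "(f1 has_real_derivative f2 z) (at z)" for z
    unfolding f1_def f2_def
    by (rule DERIV_cong, (rule DM DERIV_add)+) (simp add: M_def eval_nat_numeral field_simps)
  have D2: "(f2 has_real_derivative f3 z) (at z)" for z
    unfolding f2_def f3_def c0_def c1_def c2_def c3_def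
    by (rule DERIV_cong, (rule DM DERIV_add)+) (simp add: M_def eval_nat_numeral field_simps)
  have D3: "(f3 has_real_derivative f4 z) (at z)" for z
    unfolding f3_def f4_def
    by (rule DERIV_cong, (rule DM DERIV_add)+) (simp add: M_def eval_nat_numeral field_simps)
  define C where "C = \<bar>c0\<bar> + \<bar>b / 2 * c0\<bar> + \<bar>c1\<bar> + \<bar>5 / 4 * c1\<bar> + \<bar>b / 2 * c1\<bar>
    + \<bar>2 * c2\<bar> + \<bar>6 / 4 * c2\<bar> + \<bar>b / 2 * c2\<bar> + \<bar>3 * c3\<bar> + \<bar>7 / 4 * c3\<bar> + \<bar>b / 2 * c3\<bar>"
  have Mle: "\<bar>M c i j z\<bar> \<le> \<bar>c\<bar> * ((1 + z\<^sup>2)\<^sup>2 * (2 * (1 + z\<^sup>2)) ^ N)" if "i \<le> 4" for c i j z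
  proof -
    have "\<bar>z\<bar> ^ i \<le> max 1 (\<bar>z\<bar> ^ 4)"
    proof (cases "\<bar>z\<bar> \<le> 1")
      case True then show ?thesis using power_le_one[of "\<bar>z\<bar>" i] by simp
    next
      case False then show ?thesis using power_increasing[OF that, of "\<bar>z\<bar>"] by simp
    qed
    also have "\<dots> \<le> (1 + z\<^sup>2)\<^sup>2"
    proof -
      have "(1 + z\<^sup>2)\<^sup>2 = 1 + 2 * z\<^sup>2 + \<bar>z\<bar> ^ 4"
        by (simp add: power2_eq_square eval_nat_numeral algebra_simps)
      then show ?thesis by simp
    qed
    finally have "\<bar>z\<bar> ^ i \<le> (1 + z\<^sup>2)\<^sup>2" .
    moreover have "wroot z ^ j \<le> 1"
      using wroot_le_1[of z] wroot_pos[of z] by (simp add: power_le_one)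
    ultimately have "\<bar>z\<bar> ^ i * wroot z ^ j * sroot z powr b \<le> (1 + z\<^sup>2)\<^sup>2 * 1 * (2 * (1 + z\<^sup>2)) ^ N"
      using N[of z] wroot_pos[of z] by (intro mult_mono) auto
    then have "\<bar>c\<bar> * (\<bar>z\<bar> ^ i * wroot z ^ j * sroot z powr b) \<le> \<bar>c\<bar> * ((1 + z\<^sup>2)\<^sup>2 * (2 * (1 + z\<^sup>2)) ^ N)"
      by (intro mult_left_mono) auto
    then show ?thesis
      using wroot_pos[of z] by (simp add: M_def m_def abs_mult power_abs mult.assoc)
  qed
  have f4: "\<bar>f4 z\<bar> \<le> C * ((1 + z\<^sup>2)\<^sup>2 * (2 * (1 + z\<^sup>2)) ^ N)" for z
    unfolding f4_def C_def distrib_right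
    by (intro order_trans[OF abs_triangle_ineq] add_mono order_trans[OF Mle]) auto
  \<comment> \<open>The last branch answers for every index from 4 on; only index 4 is
    consulted.\<close>
  define diff where "diff = (\<lambda>m::nat. if m = 0 then f0 else if m = 1 then f1 else if m = 2 then f2
    else if m = 3 then f3 else f4)"
  show ?thesis
  proof
    fix z :: real
    have "\<exists>t. \<bar>t\<bar> \<le> \<bar>z\<bar> \<and> f0 z = (\<Sum>m<4. diff m 0 / fact m * z ^ m) + diff 4 t / fact 4 * z ^ 4"
    proof (rule Maclaurin_bi_le)
      show "diff 0 = f0" by (simp add: diff_def)
      show "\<forall>m t. m < 4 \<and> \<bar>t\<bar> \<le> \<bar>z\<bar> \<longrightarrow> (diff m has_real_derivative diff (Suc m) t) (at t)"
      proof safe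
        fix m :: nat and t :: real
        assume "m < 4"
        then consider "m = 0" | "m = 1" | "m = 2" | "m = 3" by linarith
        then show "(diff m has_real_derivative diff (Suc m) t) (at t)"
          by cases (simp_all add: diff_def D0 D1 D2 D3)
      qed
    qed
    then obtain t where t: "\<bar>t\<bar> \<le> \<bar>z\<bar>"
      "f0 z = (\<Sum>m<4. diff m 0 / fact m * z ^ m) + diff 4 t / fact 4 * z ^ 4"
      by blast
    have at0: "sroot 0 = 1" "wroot 0 = 1" by (simp_all add: sroot_def wroot_def)
    have "(\<Sum>m<4. diff m 0 / fact m * z ^ m)
        = 1 + b / 2 * z + (b\<^sup>2 - 1) / 8 * z\<^sup>2 + (b ^ 3 / 48 - b / 12) * z ^ 3"
      by (simp add: diff_def eval_nat_numeral f0_def f1_def f2_def f3_def M_def m_def at0 c0_def)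
        (simp add: field_simps)
    then have "wroot z * sroot z powr b
        - (1 + b / 2 * z + (b\<^sup>2 - 1) / 8 * z\<^sup>2 + (b ^ 3 / 48 - b / 12) * z ^ 3) = f4 t / 24 * z ^ 4"
      using t(2) by (simp add: f0_def M_def m_def diff_def fact_numeral)
    also have "\<bar>\<dots>\<bar> \<le> \<bar>f4 t\<bar> * z ^ 4"
      by (simp add: abs_mult)
    also have "\<dots> \<le> (C * ((1 + t\<^sup>2)\<^sup>2 * (2 * (1 + t\<^sup>2)) ^ N)) * z ^ 4"
      by (intro mult_right_mono f4) simp
    also have "\<dots> \<le> (C * ((1 + z\<^sup>2)\<^sup>2 * (2 * (1 + z\<^sup>2)) ^ N)) * z ^ 4"
    proof -
      have "t\<^sup>2 \<le> z\<^sup>2" using t(1) by (simp add: abs_le_square_iff)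
      moreover have "C \<ge> 0" by (simp add: C_def)
      ultimately show ?thesis
        by (intro mult_right_mono mult_left_mono mult_mono power_mono) auto
    qed
    also have "\<dots> = C * 2 ^ N * z ^ 4 * (1 + z\<^sup>2) ^ (N + 2)"
      by (simp only: power_mult_distrib power_add mult_ac)
    finally show "\<bar>wroot z * sroot z powr b
        - (1 + b / 2 * z + (b\<^sup>2 - 1) / 8 * z\<^sup>2 + (b ^ 3 / 48 - b / 12) * z ^ 3)\<bar>
      \<le> (C * 2 ^ N) * z ^ 4 * (1 + z\<^sup>2) ^ (N + 2)" .
  qed
qed

subsection \<open>Hermite polynomials and the Gaussian functional\<close>

lemma poly_monom_induct:
  fixes p :: "'a::comm_monoid_add poly"
  assumes "\<And>c k. Q (monom c k)" "\<And>p q. Q p \<Longrightarrow> Q q \<Longrightarrow> Q (p + q)"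
  shows "Q p"
proof -
  have "Q (\<Sum>i\<in>A. monom (coeff p i) i)" if "finite A" for A
    using that
  proof (induction A rule: finite_induct)
    case empty
    then show ?case using assms(1)[of 0 0] by simp
  next
    case (insert x F)
    then show ?case using assms by simp
  qed
  then show ?thesis
    using poly_as_sum_of_monoms[of p] by (metis finite_atMost)
qed

text \<open>Subtracting \<open>coeff p n\<close> times \<open>B n\<close> removes the top
  coefficient, and induction does the rest. The hypothesis speaks of coefficients instead of the
  degree so that n = 0, where p must be zero, is covered. It is applied both to the Hermite
  polynomials and to the given orthogonal polynomials.\<close>

lemma monic_basis_expansion:
  fixes B :: "nat \<Rightarrow> 'a::comm_ring_1 poly"
  assumes B: "\<And>k. degree (B k) = k" "\<And>k. lead_coeff (B k) = 1"
    and p: "\<And>i. i \<ge> n \<Longrightarrow> coeff p i = 0"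
  shows "\<exists>c. p = (\<Sum>k<n. smult (c k) (B k))"
  using p
proof (induction n arbitrary: p)
  case 0
  then show ?case by (simp add: poly_eq_iff)
next
  case (Suc n)
  have "\<exists>c. p - smult (coeff p n) (B n) = (\<Sum>k<n. smult (c k) (B k))"
  proof (rule Suc.IH)
    fix i assume "i \<ge> n"
    then consider "i = n" | "i \<ge> Suc n" by linarith
    then show "coeff (p - smult (coeff p n) (B n)) i = 0"
    proof cases
      case 1
      then show ?thesis using B[of n] by simp
    next
      case 2
      then show ?thesis using B(1)[of n] Suc.prems[of i] by (simp add: coeff_eq_0)
    qed
  qed
  then obtain c where "p - smult (coeff p n) (B n) = (\<Sum>k<n. smult (c k) (B k))" ..
  then have "p = (\<Sum>k<Suc n. smult ((c(n := coeff p n)) k) (B k))"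
    by (simp add: algebra_simps)
  then show ?case by blast
qed

section \<open>Moments of the Gaussian functional\<close>

definition gauss :: "real poly \<Rightarrow> real" where
  "gauss p = (LINT u|lborel. poly p u * exp (- u\<^sup>2))"

lemma has_bochner_integral_gauss_even:
  "has_bochner_integral lborel (\<lambda>u::real. u ^ (2 * k) * exp (- u\<^sup>2))
     (sqrt pi * (fact (2 * k) / (2 ^ (2 * k) * fact k)))"
  using has_bochner_integral_even_function[OF gaussian_moment_even_pos[where k = k]]
  by (simp add: mult.commute)

lemma has_bochner_integral_gauss_odd:
  "has_bochner_integral lborel (\<lambda>u::real. u ^ (2 * k + 1) * exp (- u\<^sup>2)) 0"
  using has_bochner_integral_odd_function[OF gaussian_moment_odd_pos[where k = k]]
  by (simp add: mult.commute)

lemma integrable_gauss: "integrable lborel (\<lambda>u. poly (p :: real poly) u * exp (- u\<^sup>2))"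
proof (induction p rule: poly_monom_induct)
  case (1 c k)
  have "integrable lborel (\<lambda>u::real. u ^ k * exp (- u\<^sup>2))"
    using has_bochner_integral_gauss_even[THEN integrable.intros, of "k div 2"]
      has_bochner_integral_gauss_odd[THEN integrable.intros, of "k div 2"]
    by (cases "even k") simp_all
  from integrable_mult_right[OF this, of c] show ?case
    by (simp only: poly_monom mult.assoc)
next
  case (2 p q)
  then show ?case by (simp add: distrib_right)
qed

lemma gauss_add: "gauss (p + q) = gauss p + gauss q"
  by (simp add: gauss_def distrib_right integrable_gauss)

lemma gauss_smult: "gauss (smult c p) = c * gauss p"
  by (simp add: gauss_def mult.assoc)

lemma gauss_0 [simp]: "gauss 0 = 0"
  by (simp add: gauss_def)

lemma gauss_diff: "gauss (p - q) = gauss p - gauss q"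
  by (simp add: gauss_def left_diff_distrib integrable_gauss)

lemma gauss_monom: "gauss (monom c k) = c * gauss (monom 1 k)"
  by (simp add: gauss_smult[symmetric] smult_monom)

lemma gauss_monom_odd: "odd k \<Longrightarrow> gauss (monom 1 k) = 0"
  using has_bochner_integral_integral_eq[OF has_bochner_integral_gauss_odd]
  by (auto elim!: oddE simp: gauss_def poly_monom)

lemma gauss_1: "gauss 1 = sqrt pi"
  using has_bochner_integral_integral_eq[OF has_bochner_integral_gauss_even, of 0]
  by (simp add: gauss_def)

lemma gauss_monom_Suc_Suc: "gauss (monom 1 (Suc (Suc k))) = (real k + 1) / 2 * gauss (monom 1 k)"
proof (cases "even k")
  case True
  then obtain l where l: "k = 2 * l" by (elim evenE)
  have even: "gauss (monom 1 (2 * j)) = sqrt pi * (fact (2 * j) / (2 ^ (2 * j) * fact j))" for j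
    using has_bochner_integral_integral_eq[OF has_bochner_integral_gauss_even, of j]
    by (simp add: gauss_def poly_monom)
  have "gauss (monom 1 (2 * Suc l)) = (real (2 * l) + 1) / 2 * gauss (monom 1 (2 * l))"
    unfolding even by (simp add: divide_simps) (simp add: algebra_simps)
  then show ?thesis by (simp add: l)
qed (simp add: gauss_monom_odd)

text \<open>Integration by parts against exp (- u^2). On monomials it is just the recursion of the
  moments, so no boundary terms have to be discussed.\<close>

lemma gauss_pderiv: "gauss (pderiv p) = 2 * gauss (pCons 0 p)"
proof (induction p rule: poly_monom_induct)
  case (1 c k)
  show ?case
  proof (cases k)
    case 0
    then show ?thesis
      by (simp add: pderiv_monom gauss_monom_odd flip: monom_Suc, subst gauss_monom, simp add: gauss_monom_odd)
  next
    case (Suc l)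
    then show ?thesis
      by (simp add: pderiv_monom flip: monom_Suc, subst (1 2) gauss_monom, simp add: gauss_monom_Suc_Suc)
  qed
next
  case (2 p q)
  have "pCons 0 (p + q) = pCons 0 p + pCons 0 q" by simp
  then show ?case using 2 by (simp only: pderiv_add gauss_add) simp
qed

lemma gauss_odd:
  assumes "\<And>u. poly p (- u) = - poly p u"
  shows "gauss p = 0"
proof -
  have "gauss p = (LINT u|lborel. poly p (- u) * exp (- (- u)\<^sup>2))"
    unfolding gauss_def using lborel_integral_real_affine[of "-1" "\<lambda>u. poly p u * exp (- u\<^sup>2)" 0] by simp
  also have "\<dots> = - gauss p"
    by (simp add: assms gauss_def)
  finally show ?thesis by simp
qed

section \<open>Monic Hermite polynomials (the physicists' ones divided by 2^n)\<close>

primrec herm :: "nat \<Rightarrow> real poly" where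
  "herm 0 = 1"
| "herm (Suc n) = pCons 0 (herm n) - smult (1 / 2) (pderiv (herm n))"

text \<open>After differentiating the recursion, the induction hypothesis turns the last two terms
  into n + 1 times the right-hand side of the recursion for \<open>herm (Suc n)\<close>.\<close>

lemma pderiv_herm_Suc: "pderiv (herm (Suc n)) = smult (real (Suc n)) (herm n)"
proof (induction n)
  case 0
  show ?case by (simp add: pderiv_pCons)
next
  case (Suc n)
  have "pderiv (herm (Suc (Suc n)))
      = herm (Suc n) + pCons 0 (pderiv (herm (Suc n))) - smult (1 / 2) (pderiv (pderiv (herm (Suc n))))"
    by (simp only: herm.simps(2)[of "Suc n"] pderiv_diff pderiv_pCons pderiv_smult)
  also have "\<dots> = herm (Suc n) + smult (real (Suc n)) (herm (Suc n))"
    unfolding Suc.IH by (rule poly_eqI) (simp add: pderiv_smult coeff_pCons algebra_simps split: nat.split)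
  also have "\<dots> = smult (real (Suc (Suc n))) (herm (Suc n))"
    by (simp only: of_nat_Suc[of "Suc n"] smult_add_left smult_1_left add.commute)
  finally show ?case .
qed

lemma pderiv_herm: "pderiv (herm n) = smult (real n) (herm (n - 1))"
  by (cases n) (simp_all add: pderiv_herm_Suc del: herm.simps(2))

lemma pCons_0_herm: "pCons 0 (herm n) = herm (Suc n) + smult (real n / 2) (herm (n - 1))"
  by (simp add: pderiv_herm)

lemma herm_monic: "degree (herm n) = n \<and> lead_coeff (herm n) = 1"
proof (induction n)
  case (Suc n)
  have "herm n \<noteq> 0" using Suc by auto
  then have deg: "degree (pCons 0 (herm n)) = Suc n" "degree (- smult (1 / 2) (pderiv (herm n))) < Suc n"
    using Suc by (simp_all add: degree_pderiv)
  then have "degree (herm (Suc n)) = Suc n"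
    using degree_add_eq_left[of "- smult (1 / 2) (pderiv (herm n))" "pCons 0 (herm n)"] by simp
  moreover have "coeff (pderiv (herm n)) (Suc n) = 0"
    using deg by (intro coeff_eq_0) simp
  ultimately show ?case using Suc by auto
qed simp

lemma poly_herm_Suc_Suc:
  "poly (herm (Suc (Suc n))) x = x * poly (herm (Suc n)) x - real (Suc n) / 2 * poly (herm n) x"
  unfolding herm.simps(2)[of "Suc n"] by (simp add: pderiv_herm_Suc del: herm.simps)

lemma poly_herm_minus: "poly (herm n) (- u) = (- 1) ^ n * poly (herm n) u"
proof (induction n rule: induct_nat_012)
  case (ge2 n)
  then show ?case
    unfolding poly_herm_Suc_Suc by (simp add: algebra_simps del: herm.simps)
qed simp_all

text \<open>Multiplication by u minus half the derivative is adjoint to half the derivative.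
  Repeated use moves all raising steps onto the other factor, which gives both orthogonality and the
  norms.\<close>

lemma gauss_herm_Suc_mult: "gauss (herm (Suc n) * g) = gauss (herm n * pderiv g) / 2"
proof -
  have "gauss (pderiv (herm n * g)) = 2 * gauss (pCons 0 (herm n) * g)"
    by (simp add: gauss_pderiv)
  then show ?thesis
    by (simp add: pderiv_mult gauss_add gauss_diff left_diff_distrib gauss_smult algebra_simps)
qed

lemma gauss_herm_mult_eq_0:
  assumes "degree g < n"
  shows "gauss (herm n * g) = 0"
  using assms
proof (induction n arbitrary: g)
  case (Suc n)
  show ?case
  proof (cases "degree g")
    case 0
    then show ?thesis
      by (simp add: gauss_herm_Suc_mult pderiv_eq_0_iff[THEN iffD2] del: herm.simps)
  next
    case (Suc m)
    with Suc.prems have "degree (pderiv g) < n" by (simp add: degree_pderiv)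
    then show ?thesis
      using Suc.IH by (simp add: gauss_herm_Suc_mult del: herm.simps)
  qed
qed simp

text \<open>This is the squared norm of \<open>herm n\<close>, by \<open>gauss_herm_herm\<close>;
  its logarithm becomes the constant term \<open>C_hat n\<close>.\<close>

definition herm_norm :: "nat \<Rightarrow> real" where
  "herm_norm n = sqrt pi * fact n / 2 ^ n"

lemma herm_norm_pos: "herm_norm n > 0"
  by (simp add: herm_norm_def)

lemma herm_norm_Suc: "herm_norm (Suc n) = real (Suc n) / 2 * herm_norm n"
  by (simp add: herm_norm_def)

lemma gauss_herm_herm: "gauss (herm m * herm n) = (if m = n then herm_norm n else 0)"
proof -
  have "gauss (herm n * herm n) = herm_norm n"
  proof (induction n)
    case 0
    show ?case by (simp add: gauss_1 herm_norm_def)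
  next
    case (Suc n)
    then show ?case
      by (simp add: gauss_herm_Suc_mult pderiv_herm_Suc herm_norm_Suc gauss_smult del: herm.simps)
  qed
  moreover have "gauss (herm m * herm n) = 0" if "m > n" for m n
    using that by (intro gauss_herm_mult_eq_0) (simp add: herm_monic)
  ultimately show ?thesis
    by (metis linorder_neqE_nat mult.commute)
qed

subsection \<open>Second order perturbation of the Hermite norms\<close>

text \<open>The split fits the indices n - 1, n - 2 and n - 3 below: truncation can occur only in
  the first three cases, which are checked one by one.\<close>

lemma nat_cases_012:
  obtains "n = 0" | "n = 1" | "n = 2" | m :: nat where "n = Suc (Suc (Suc m))"
  by (metis One_nat_def numeral_2_eq_2 old.nat.exhaust)

lemma X_mult_herm: "monom 1 1 * herm n = herm (n + 1) + smult (real n / 2) (herm (n - 1))"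
  using pCons_0_herm[of n] by (simp add: monom_Suc del: herm.simps)

text \<open>Iterated three-term recurrence. Each coefficient vanishes whenever the index of its
  Hermite polynomial would be negative, so truncated subtraction does no harm.\<close>

lemma X3_mult_herm:
  "monom 1 3 * herm n = herm (n + 3) + smult (3 * (real n + 1) / 2) (herm (n + 1))
    + smult (3 * (real n)\<^sup>2 / 4) (herm (n - 1))
    + smult (real n * (real n - 1) * (real n - 2) / 8) (herm (n - 3))"
  and X2_mult_herm:
  "monom 1 2 * herm n = herm (n + 2) + smult (real n + 1 / 2) (herm n)
    + smult (real n * (real n - 1) / 4) (herm (n - 2))"
proof -
  have h1: "poly (herm (Suc 0)) x = x * poly (herm 0) x" for x by simp
  note step = poly_herm_Suc_Suc h1
  show "monom 1 3 * herm n = herm (n + 3) + smult (3 * (real n + 1) / 2) (herm (n + 1))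
      + smult (3 * (real n)\<^sup>2 / 4) (herm (n - 1))
      + smult (real n * (real n - 1) * (real n - 2) / 8) (herm (n - 3))"
    unfolding poly_eq_poly_eq_iff[symmetric] fun_eq_iff
    by (cases rule: nat_cases_012[of n])
      (simp_all add: step poly_monom eval_nat_numeral field_simps del: herm.simps)
  show "monom 1 2 * herm n = herm (n + 2) + smult (real n + 1 / 2) (herm n)
    + smult (real n * (real n - 1) / 4) (herm (n - 2))"
    unfolding poly_eq_poly_eq_iff[symmetric] fun_eq_iff
    by (cases rule: nat_cases_012[of n])
      (simp_all add: step poly_monom eval_nat_numeral field_simps del: herm.simps)
qed

text \<open>
  The polynomials \<open>pert1\<close>, \<open>pert2\<close> and, further below, \<open>pert3\<close> are the coefficients of \<open>\<epsilon>\<close>, \<open>\<epsilon>\<^sup>2\<close> and \<open>\<epsilon>\<^sup>3\<close>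
  in the expansion of \<open>(1 + \<epsilon> u) powr \<alpha> * exp (\<epsilon> u\<^sup>3 - \<epsilon>\<^sup>2 u\<^sup>4 + \<epsilon>\<^sup>3 u\<^sup>5)\<close>, the rescaled weight divided by
  the Gaussian when the variable is \<open>(x - \<sigma>\<^sup>2) / \<sigma>\<close>.
\<close>

definition pert1 :: "real \<Rightarrow> real poly" where
  "pert1 \<alpha> = monom 1 3 + monom \<alpha> 1"

definition pert2 :: "real \<Rightarrow> real poly" where
  "pert2 \<alpha> = monom (1 / 2) 6 + monom (\<alpha> - 1) 4 + monom ((\<alpha>\<^sup>2 - \<alpha>) / 2) 2"

text \<open>
  \<open>corr\<close> cancels the components of \<open>pert1 \<alpha> * herm n\<close> of degree below \<open>n\<close>. For \<open>n < 3\<close> the truncated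
  subtractions are harmless, because the coefficients in front vanish.
\<close>

definition corr :: "real \<Rightarrow> nat \<Rightarrow> real poly" where
  "corr \<alpha> n = - (smult (3 * (real n)\<^sup>2 / 4 + \<alpha> * real n / 2) (herm (n - 1))
    + smult (real n * (real n - 1) * (real n - 2) / 8) (herm (n - 3)))"

text \<open>Only Hermite polynomials of degree above n remain on the right; this is the property for
  which \<open>corr\<close> was chosen.\<close>

lemma pert1_mult_herm:
  "pert1 \<alpha> * herm n + corr \<alpha> n = herm (n + 3) + smult (3 * (real n + 1) / 2 + \<alpha>) (herm (n + 1))"
proof -
  have "monom \<alpha> 1 = smult \<alpha> (monom 1 1)" by (simp add: smult_monom)
  then have "pert1 \<alpha> * herm n = monom 1 3 * herm n + smult \<alpha> (monom 1 1 * herm n)"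
    by (simp add: pert1_def distrib_right)
  then show ?thesis
    unfolding X3_mult_herm X_mult_herm corr_def
    by (simp add: smult_add_left smult_add_right mult.commute del: herm.simps)
qed

text \<open>The left-hand side is the coefficient of \<epsilon> when the trial polynomial is paired
  with r, so lower degrees are not seen at first order.\<close>

lemma gauss_first_order:
  assumes "degree r < n"
  shows "gauss (corr \<alpha> n * r) + gauss (pert1 \<alpha> * (herm n * r)) = 0"
proof -
  have "gauss (corr \<alpha> n * r) + gauss (pert1 \<alpha> * (herm n * r)) = gauss ((pert1 \<alpha> * herm n + corr \<alpha> n) * r)"
    by (simp add: distrib_right gauss_add mult.assoc)
  also have "\<dots> = 0"
    unfolding pert1_mult_herm
    using assms by (simp add: distrib_right gauss_add gauss_smult gauss_herm_mult_eq_0 del: herm.simps)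
  finally show ?thesis .
qed

text \<open>Here and in the next two lemmas the norm recursion is multiplied by a squared falling
  factorial, which makes it valid for small n as well, where the subtraction truncates.\<close>

lemma herm_norm_pred: "(real n)\<^sup>2 * herm_norm (n - 1) = 2 * real n * herm_norm n"
  by (cases n) (simp_all add: herm_norm_Suc power2_eq_square)

lemma herm_norm_pred2:
  "(real n * (real n - 1))\<^sup>2 * herm_norm (n - 2) = 4 * (real n * (real n - 1)) * herm_norm n"
  by (cases rule: nat_cases_012[of n]) (simp_all add: herm_norm_Suc numeral_2_eq_2 power2_eq_square)

lemma herm_norm_pred3:
  "(real n * (real n - 1) * (real n - 2))\<^sup>2 * herm_norm (n - 3)
    = 8 * (real n * (real n - 1) * (real n - 2)) * herm_norm n"
  by (cases rule: nat_cases_012[of n])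
    (simp_all add: herm_norm_Suc numeral_2_eq_2 numeral_3_eq_3 power2_eq_square)

text \<open>Pythagoras for Hermite expansions. The vanishing conditions, here and in the next lemma,
  remove the truncated indices, which could otherwise coincide with another index of the
  sum.\<close>

lemma gauss_square_even_shifts:
  fixes a b c :: real
  assumes "n < 2 \<Longrightarrow> c = 0"
    and p: "p = smult a (herm (n + 2)) + smult b (herm n) + smult c (herm (n - 2))"
  shows "gauss (p * p) = a\<^sup>2 * herm_norm (n + 2) + b\<^sup>2 * herm_norm n + c\<^sup>2 * herm_norm (n - 2)"
  using assms(1) unfolding p
  by (cases rule: nat_cases_012[of n])
    (simp_all add: gauss_add gauss_smult distrib_left distrib_right gauss_herm_herm
      numeral_2_eq_2 power2_eq_square del: herm.simps)

lemma gauss_square_odd_shifts: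
  fixes a b c d :: real
  assumes "n < 3 \<Longrightarrow> d = 0" "n < 1 \<Longrightarrow> c = 0"
    and p: "p = smult a (herm (n + 3)) + smult b (herm (n + 1)) + smult c (herm (n - 1)) + smult d (herm (n - 3))"
  shows "gauss (p * p) = a\<^sup>2 * herm_norm (n + 3) + b\<^sup>2 * herm_norm (n + 1) + c\<^sup>2 * herm_norm (n - 1)
    + d\<^sup>2 * herm_norm (n - 3)"
  using assms(1,2) unfolding p
  by (cases rule: nat_cases_012[of n])
    (simp_all add: gauss_add gauss_smult distrib_left distrib_right gauss_herm_herm
      numeral_2_eq_2 numeral_3_eq_3 power2_eq_square del: herm.simps)

lemma gauss_X3_square:
  "gauss ((monom 1 3 * herm n) * (monom 1 3 * herm n))
    = herm_norm n * (5 / 8 * (4 * real n ^ 3 + 6 * (real n)\<^sup>2 + 8 * real n + 3))"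
proof -
  define x where "x = real n"
  have "gauss ((monom 1 3 * herm n) * (monom 1 3 * herm n)) =
      1\<^sup>2 * herm_norm (n + 3) + (3 * (x + 1) / 2)\<^sup>2 * herm_norm (n + 1)
      + (3 * x\<^sup>2 / 4)\<^sup>2 * herm_norm (n - 1) + (x * (x - 1) * (x - 2) / 8)\<^sup>2 * herm_norm (n - 3)"
  proof (rule gauss_square_odd_shifts)
    show "monom 1 3 * herm n = smult 1 (herm (n + 3)) + smult (3 * (x + 1) / 2) (herm (n + 1))
        + smult (3 * x\<^sup>2 / 4) (herm (n - 1)) + smult (x * (x - 1) * (x - 2) / 8) (herm (n - 3))"
      by (simp only: X3_mult_herm x_def smult_1_left)
  qed (auto simp: x_def less_Suc_eq numeral_3_eq_3)
  also have "herm_norm (n + 3) = (x + 3) * (x + 2) * (x + 1) / 8 * herm_norm n"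
    by (simp add: numeral_3_eq_3 herm_norm_Suc x_def field_simps)
  also have "herm_norm (n + 1) = (x + 1) / 2 * herm_norm n"
    by (simp add: herm_norm_Suc x_def)
  \<comment> \<open>One factor x^2 stays next to \<open>herm_norm (n - 1)\<close>, so that
    \<open>herm_norm_pred\<close> applies for n = 0 too.\<close>
  also have "(3 * x\<^sup>2 / 4)\<^sup>2 * herm_norm (n - 1) = 9 / 16 * x\<^sup>2 * (x\<^sup>2 * herm_norm (n - 1))"
    by (simp add: power2_eq_square)
  also have "x\<^sup>2 * herm_norm (n - 1) = 2 * x * herm_norm n"
    using herm_norm_pred[of n] by (simp add: x_def)
  also have "(x * (x - 1) * (x - 2) / 8)\<^sup>2 * herm_norm (n - 3) = x * (x - 1) * (x - 2) / 8 * herm_norm n"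
    using herm_norm_pred3[of n] by (simp add: x_def power_divide)
  also have "1\<^sup>2 * ((x + 3) * (x + 2) * (x + 1) / 8 * herm_norm n)
      + (3 * (x + 1) / 2)\<^sup>2 * ((x + 1) / 2 * herm_norm n)
      + 9 / 16 * x\<^sup>2 * (2 * x * herm_norm n) + x * (x - 1) * (x - 2) / 8 * herm_norm n
    = herm_norm n * (5 / 8 * (4 * x ^ 3 + 6 * x\<^sup>2 + 8 * x + 3))"
    by (simp add: power2_eq_square power3_eq_cube field_simps)
  finally show ?thesis
    unfolding x_def .
qed

lemma gauss_X2_square:
  "gauss ((monom 1 2 * herm n) * (monom 1 2 * herm n))
    = herm_norm n * (3 / 4 * (2 * (real n)\<^sup>2 + 2 * real n + 1))"
proof -
  define x where "x = real n"
  have "gauss ((monom 1 2 * herm n) * (monom 1 2 * herm n)) =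
      1\<^sup>2 * herm_norm (n + 2) + (x + 1 / 2)\<^sup>2 * herm_norm n + (x * (x - 1) / 4)\<^sup>2 * herm_norm (n - 2)"
  proof (rule gauss_square_even_shifts)
    show "monom 1 2 * herm n = smult 1 (herm (n + 2)) + smult (x + 1 / 2) (herm n)
        + smult (x * (x - 1) / 4) (herm (n - 2))"
      by (simp only: X2_mult_herm x_def smult_1_left)
  qed (auto simp: x_def less_Suc_eq numeral_2_eq_2)
  also have "herm_norm (n + 2) = (x + 2) * (x + 1) / 4 * herm_norm n"
    by (simp add: numeral_2_eq_2 herm_norm_Suc x_def field_simps)
  also have "(x * (x - 1) / 4)\<^sup>2 * herm_norm (n - 2) = x * (x - 1) / 4 * herm_norm n"
    using herm_norm_pred2[of n] by (simp add: x_def power_divide)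
  finally show ?thesis
    unfolding x_def[symmetric] by (simp add: power2_eq_square field_simps)
qed

lemma gauss_X_square:
  "gauss ((monom 1 1 * herm n) * (monom 1 1 * herm n)) = herm_norm n * (real n + 1 / 2)"
proof -
  define x where "x = real n"
  have "gauss ((monom 1 1 * herm n) * (monom 1 1 * herm n)) =
      herm_norm (n + 1) + (x / 2)\<^sup>2 * herm_norm (n - 1)"
    unfolding X_mult_herm x_def
    by (cases n)
      (simp_all add: gauss_add gauss_smult distrib_left distrib_right gauss_herm_herm
        power2_eq_square del: herm.simps)
  also have "herm_norm (n + 1) = (x + 1) / 2 * herm_norm n"
    by (simp add: herm_norm_Suc x_def)
  also have "(x / 2)\<^sup>2 * herm_norm (n - 1) = x / 2 * herm_norm n"
    using herm_norm_pred[of n] by (simp add: x_def power_divide)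
  finally show ?thesis
    unfolding x_def[symmetric] by (simp add: field_simps)
qed

lemma gauss_pert2:
  "gauss (pert2 \<alpha> * (herm n * herm n)) = herm_norm n *
    (5 / 16 * (4 * real n ^ 3 + 6 * (real n)\<^sup>2 + 8 * real n + 3)
     + (\<alpha> - 1) * (3 / 4 * (2 * (real n)\<^sup>2 + 2 * real n + 1)) + (\<alpha>\<^sup>2 - \<alpha>) / 2 * (real n + 1 / 2))"
proof -
  \<comment> \<open>Even monomials are squares, so each term of \<open>pert2\<close> contributes the
    squared norm of u^k times \<open>herm n\<close>.\<close>
  have *: "monom c (2 * k) = smult c (monom 1 k * monom 1 k)" for c :: real and k
    by (simp add: mult_monom smult_monom mult_2)
  have "pert2 \<alpha> * (herm n * herm n) = smult (1 / 2) ((monom 1 3 * herm n) * (monom 1 3 * herm n))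
    + smult (\<alpha> - 1) ((monom 1 2 * herm n) * (monom 1 2 * herm n))
    + smult ((\<alpha>\<^sup>2 - \<alpha>) / 2) ((monom 1 1 * herm n) * (monom 1 1 * herm n))"
    using *[of "1 / 2" 3] *[of "\<alpha> - 1" 2] *[of "(\<alpha>\<^sup>2 - \<alpha>) / 2" 1]
    by (simp add: pert2_def distrib_right) (simp only: mult_ac)
  then show ?thesis
    by (simp only: gauss_add gauss_smult gauss_X3_square gauss_X2_square gauss_X_square distrib_left)
      (simp add: field_simps)
qed

lemma gauss_corr_corr:
  "gauss (corr \<alpha> n * corr \<alpha> n) = herm_norm n *
    (real n * (real n - 1) * (real n - 2) / 8 + real n / 2 * (3 * real n / 2 + \<alpha>)\<^sup>2)"
proof -
  define x where "x = real n"
  have "gauss (corr \<alpha> n * corr \<alpha> n) = 0\<^sup>2 * herm_norm (n + 3) + 0\<^sup>2 * herm_norm (n + 1)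
      + (- (3 * x\<^sup>2 / 4 + \<alpha> * x / 2))\<^sup>2 * herm_norm (n - 1)
      + (- (x * (x - 1) * (x - 2) / 8))\<^sup>2 * herm_norm (n - 3)"
  proof (rule gauss_square_odd_shifts)
    show "corr \<alpha> n = smult 0 (herm (n + 3)) + smult 0 (herm (n + 1))
        + smult (- (3 * x\<^sup>2 / 4 + \<alpha> * x / 2)) (herm (n - 1))
        + smult (- (x * (x - 1) * (x - 2) / 8)) (herm (n - 3))"
      by (simp only: corr_def x_def smult_minus_left) simp
  qed (auto simp: x_def less_Suc_eq numeral_3_eq_3)
  also have "\<dots> = (3 * x\<^sup>2 / 4 + \<alpha> * x / 2)\<^sup>2 * herm_norm (n - 1)
      + (x * (x - 1) * (x - 2) / 8)\<^sup>2 * herm_norm (n - 3)"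
    by (simp only: power2_minus) simp
  also have "(x * (x - 1) * (x - 2) / 8)\<^sup>2 * herm_norm (n - 3) = x * (x - 1) * (x - 2) / 8 * herm_norm n"
    using herm_norm_pred3[of n] by (simp add: x_def power_divide)
  also have "(3 * x\<^sup>2 / 4 + \<alpha> * x / 2)\<^sup>2 * herm_norm (n - 1)
      = (3 * x / 2 + \<alpha>)\<^sup>2 / 4 * (x\<^sup>2 * herm_norm (n - 1))"
    by (simp add: power2_eq_square field_simps)
  also have "x\<^sup>2 * herm_norm (n - 1) = 2 * x * herm_norm n"
    using herm_norm_pred[of n] by (simp add: x_def)
  finally show ?thesis
    unfolding x_def[symmetric] by (simp add: field_simps)
qed

text \<open>The left-hand side is the \<epsilon>^2 coefficient of the squared norm of the trial
  polynomial. Since \<open>corr\<close> itself has degree below n, \<open>gauss_first_order\<close>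
  may be applied to it: the cross term is minus the squared norm of \<open>corr\<close>, and the sum
  collapses to the \<open>pert2\<close> term minus that norm.\<close>

lemma gauss_second_order:
  "gauss (pert2 \<alpha> * (herm n * herm n)) + 2 * gauss (pert1 \<alpha> * (herm n * corr \<alpha> n))
     + gauss (corr \<alpha> n * corr \<alpha> n)
   = herm_norm n * ((2 * \<alpha> + 2 * real n + 1) * (2 * \<alpha> + 6 * real n + 3) / 16)"
proof -
  have "gauss (corr \<alpha> n * corr \<alpha> n) + gauss (pert1 \<alpha> * (herm n * corr \<alpha> n)) = 0"
  \<comment> \<open>For n = 0 no degree is below n, but then \<open>corr\<close> is zero.\<close>
  proof (cases "n = 0")
    case True
    then show ?thesis by (simp add: corr_def)
  next
    case False
    have "degree (corr \<alpha> n) < n"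
      unfolding corr_def degree_minus
      by (rule degree_add_less; rule le_less_trans[OF degree_smult_le]) (use False herm_monic in auto)
    then show ?thesis by (rule gauss_first_order)
  qed
  then have "gauss (pert2 \<alpha> * (herm n * herm n)) + 2 * gauss (pert1 \<alpha> * (herm n * corr \<alpha> n))
     + gauss (corr \<alpha> n * corr \<alpha> n)
    = gauss (pert2 \<alpha> * (herm n * herm n)) - gauss (corr \<alpha> n * corr \<alpha> n)"
    by simp
  also have "\<dots> = herm_norm n * ((2 * \<alpha> + 2 * real n + 1) * (2 * \<alpha> + 6 * real n + 3) / 16)"
    unfolding gauss_pert2 gauss_corr_corr
    by (simp add: power2_eq_square power3_eq_cube field_simps)
  finally show ?thesis .
qed

subsection \<open>Expansion of the rescaled weight\<close>

definition pert3 :: "real \<Rightarrow> real poly" where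
  "pert3 \<alpha> = monom (1 / 6) 9 + monom (\<alpha> / 2 - 1) 7 + monom (1 - \<alpha> + \<alpha> * (\<alpha> - 1) / 2) 5
    + monom (\<alpha> * (\<alpha> - 1) * (\<alpha> - 2) / 6) 3"

lemma gauss_monom_shift:
  "gauss (monom c (k + 3)) = c * ((real k + 2) / 2) * gauss (monom 1 (k + 1))"
  using gauss_monom_Suc_Suc[of "k + 1"]
  by (subst gauss_monom) (simp add: numeral_3_eq_3)

text \<open>Substituting exactly and expanding the weight in (x - \<sigma>^2) / \<sigma> give
  different integrands but equal integrals at each order. This lemma and the next two verify it:
  with b = 2 \<alpha> + 2 + k the factors on the right are the Taylor coefficients in
  \<open>sroot_powr_Maclaurin\<close>, and the moment recursion brings the left-hand sides to the
  same single moment.\<close>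

lemma gauss_monom_pert1:
  "gauss (pert1 \<alpha> * monom 1 k) = (2 * \<alpha> + 2 + real k) / 2 * gauss (monom 1 (k + 1))"
proof -
  have "pert1 \<alpha> * monom 1 k = monom 1 (k + 3) + monom \<alpha> (k + 1)"
    by (simp add: pert1_def distrib_right mult_monom add.commute)
  then have "gauss (pert1 \<alpha> * monom 1 k) = ((real k + 2) / 2 + \<alpha>) * gauss (monom 1 (k + 1))"
    by (simp only: gauss_add gauss_monom_shift gauss_monom[of \<alpha>] mult_1_left distrib_right)
  then show ?thesis by (simp add: field_simps)
qed

lemma gauss_monom_pert2:
  "gauss (pert2 \<alpha> * monom 1 k) = ((2 * \<alpha> + 2 + real k)\<^sup>2 - 1) / 8 * gauss (monom 1 (k + 2))"
proof -
  define x where "x = real k"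
  define m where "m = gauss (monom 1 (k + 2))"
  have s2: "gauss (monom c (k + 4)) = c * ((x + 3) / 2) * m" for c
    using gauss_monom_shift[of c "k + 1"] by (simp add: x_def m_def eval_nat_numeral add_ac)
  have s3: "gauss (monom c (k + 6)) = c * ((x + 5) / 2) * gauss (monom 1 (k + 4))" for c
    using gauss_monom_shift[of c "k + 3"] by (simp add: x_def eval_nat_numeral add_ac)
  have "pert2 \<alpha> * monom 1 k = monom (1 / 2) (k + 6) + monom (\<alpha> - 1) (k + 4) + monom ((\<alpha>\<^sup>2 - \<alpha>) / 2) (k + 2)"
    by (simp add: pert2_def distrib_right mult_monom add.commute)
  then have "gauss (pert2 \<alpha> * monom 1 k)
      = (1 / 2 * ((x + 5) / 2) * ((x + 3) / 2) + (\<alpha> - 1) * ((x + 3) / 2) + (\<alpha>\<^sup>2 - \<alpha>) / 2) * m"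
    by (simp only: gauss_add s3 s2 gauss_monom[of "(\<alpha>\<^sup>2 - \<alpha>) / 2"] m_def[symmetric] mult_1_left
        distrib_right mult.assoc)
  also have "1 / 2 * ((x + 5) / 2) * ((x + 3) / 2) + (\<alpha> - 1) * ((x + 3) / 2) + (\<alpha>\<^sup>2 - \<alpha>) / 2
      = ((2 * \<alpha> + 2 + x)\<^sup>2 - 1) / 8"
    by (simp add: field_simps power2_eq_square)
  finally show ?thesis by (simp only: x_def m_def)
qed

lemma gauss_monom_pert3:
  "gauss (pert3 \<alpha> * monom 1 k)
    = ((2 * \<alpha> + 2 + real k) ^ 3 / 48 - (2 * \<alpha> + 2 + real k) / 12) * gauss (monom 1 (k + 3))"
proof -
  define x where "x = real k"
  define m where "m = gauss (monom 1 (k + 3))"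
  define c5 where "c5 = 1 - \<alpha> + \<alpha> * (\<alpha> - 1) / 2"
  define c3 where "c3 = \<alpha> * (\<alpha> - 1) * (\<alpha> - 2) / 6"
  have s4: "gauss (monom c (k + 5)) = c * ((x + 4) / 2) * m" for c
    using gauss_monom_shift[of c "k + 2"] by (simp add: x_def m_def eval_nat_numeral add_ac)
  have s5: "gauss (monom c (k + 7)) = c * ((x + 6) / 2) * gauss (monom 1 (k + 5))" for c
    using gauss_monom_shift[of c "k + 4"] by (simp add: x_def eval_nat_numeral add_ac)
  have s6: "gauss (monom c (k + 9)) = c * ((x + 8) / 2) * gauss (monom 1 (k + 7))" for c
    using gauss_monom_shift[of c "k + 6"] by (simp add: x_def eval_nat_numeral add_ac)
  have "pert3 \<alpha> * monom 1 k = monom (1 / 6) (k + 9) + monom (\<alpha> / 2 - 1) (k + 7) + monom c5 (k + 5) + monom c3 (k + 3)"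
    by (simp add: pert3_def c5_def c3_def distrib_right mult_monom add.commute)
  then have "gauss (pert3 \<alpha> * monom 1 k)
      = (1 / 6 * ((x + 8) / 2) * ((x + 6) / 2) * ((x + 4) / 2) + (\<alpha> / 2 - 1) * ((x + 6) / 2) * ((x + 4) / 2)
        + c5 * ((x + 4) / 2) + c3) * m"
    by (simp only: gauss_add s6 s5 s4 gauss_monom[of c3] m_def[symmetric] mult_1_left distrib_right mult.assoc)
  also have "1 / 6 * ((x + 8) / 2) * ((x + 6) / 2) * ((x + 4) / 2) + (\<alpha> / 2 - 1) * ((x + 6) / 2) * ((x + 4) / 2)
        + c5 * ((x + 4) / 2) + c3 = (2 * \<alpha> + 2 + x) ^ 3 / 48 - (2 * \<alpha> + 2 + x) / 12"
    by (simp add: c5_def c3_def field_simps power3_eq_cube)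
  finally show ?thesis by (simp only: x_def m_def)
qed

section \<open>Expansion of the rescaled integrals in powers of \<epsilon>\<close>

lemma sroot_borel [measurable]: "sroot \<in> borel_measurable borel"
  unfolding sroot_def [abs_def] by measurable

lemma wroot_borel [measurable]: "wroot \<in> borel_measurable borel"
  unfolding wroot_def [abs_def] by measurable

lemma poly_borel [measurable]: "poly p \<in> borel_measurable (borel :: real measure)"
  by (intro borel_measurable_continuous_onI continuous_intros)

text \<open>The Taylor formula is inserted at z = \<epsilon> u and integrated. As \<epsilon> \<le>
  1, the remainder is at most \<epsilon>^4 times a polynomial in u that does not depend on
  \<epsilon>.\<close>

lemma laplace_expansion:
  fixes b :: real and k :: nat
  shows "\<exists>C. \<forall>\<epsilon>. 0 < \<epsilon> \<and> \<epsilon> \<le> 1 \<longrightarrow>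
      integrable lborel (\<lambda>u. u ^ k * (wroot (\<epsilon> * u) * sroot (\<epsilon> * u) powr b) * exp (- u\<^sup>2)) \<and>
      \<bar>(LINT u|lborel. u ^ k * (wroot (\<epsilon> * u) * sroot (\<epsilon> * u) powr b) * exp (- u\<^sup>2))
       - (gauss (monom 1 k) + \<epsilon> * (b / 2 * gauss (monom 1 (k + 1)))
          + \<epsilon>\<^sup>2 * ((b\<^sup>2 - 1) / 8 * gauss (monom 1 (k + 2)))
          + \<epsilon> ^ 3 * ((b ^ 3 / 48 - b / 12) * gauss (monom 1 (k + 3))))\<bar> \<le> C * \<epsilon> ^ 4"
proof -
  obtain K N where KN: "\<And>z. \<bar>wroot z * sroot z powr b
        - (1 + b / 2 * z + (b\<^sup>2 - 1) / 8 * z\<^sup>2 + (b ^ 3 / 48 - b / 12) * z ^ 3)\<bar>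
      \<le> K * z ^ 4 * (1 + z\<^sup>2) ^ N"
    using sroot_powr_Maclaurin[of b] by blast
  define q :: "real poly" where "q = monom 1 (k + 4) * [:1, 0, 1:] ^ N"
  have q: "poly q u = u ^ k * u ^ 4 * (1 + u\<^sup>2) ^ N" for u
    by (simp add: q_def poly_monom power_add power2_eq_square)
  define C where "C = (LINT u|lborel. \<bar>K\<bar> * \<bar>poly q u * exp (- u\<^sup>2)\<bar>)"
  have main: "integrable lborel (\<lambda>u. u ^ k * (wroot (\<epsilon> * u) * sroot (\<epsilon> * u) powr b) * exp (- u\<^sup>2)) \<and>
      \<bar>(LINT u|lborel. u ^ k * (wroot (\<epsilon> * u) * sroot (\<epsilon> * u) powr b) * exp (- u\<^sup>2))
       - (gauss (monom 1 k) + \<epsilon> * (b / 2 * gauss (monom 1 (k + 1)))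
          + \<epsilon>\<^sup>2 * ((b\<^sup>2 - 1) / 8 * gauss (monom 1 (k + 2)))
          + \<epsilon> ^ 3 * ((b ^ 3 / 48 - b / 12) * gauss (monom 1 (k + 3))))\<bar> \<le> C * \<epsilon> ^ 4"
    if \<epsilon>: "0 < \<epsilon>" "\<epsilon> \<le> 1" for \<epsilon>
  proof -
    define T :: "real poly" where "T = monom 1 k + smult (\<epsilon> * (b / 2)) (monom 1 (k + 1))
      + smult (\<epsilon>\<^sup>2 * ((b\<^sup>2 - 1) / 8)) (monom 1 (k + 2))
      + smult (\<epsilon> ^ 3 * (b ^ 3 / 48 - b / 12)) (monom 1 (k + 3))"
    have T: "poly T u = u ^ k * (1 + b / 2 * (\<epsilon> * u) + (b\<^sup>2 - 1) / 8 * (\<epsilon> * u)\<^sup>2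
        + (b ^ 3 / 48 - b / 12) * (\<epsilon> * u) ^ 3)" for u
      by (simp only: T_def poly_add poly_smult poly_monom power_add power_mult_distrib distrib_left
          power_one_right mult_1_left mult_1_right mult_ac)
    define G where "G = (\<lambda>u. u ^ k * (wroot (\<epsilon> * u) * sroot (\<epsilon> * u) powr b) * exp (- u\<^sup>2))"
    have [measurable]: "G \<in> borel_measurable lborel"
      unfolding G_def by measurable
    have bound: "\<bar>G u - poly T u * exp (- u\<^sup>2)\<bar> \<le> \<epsilon> ^ 4 * (\<bar>K\<bar> * \<bar>poly q u * exp (- u\<^sup>2)\<bar>)" for u
    proof -
      have le: "K * (\<epsilon> * u) ^ 4 * (1 + (\<epsilon> * u)\<^sup>2) ^ N \<le> \<bar>K\<bar> * (\<epsilon> * u) ^ 4 * (1 + u\<^sup>2) ^ N"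
      proof (rule mult_mono)
        have "\<epsilon>\<^sup>2 \<le> 1" using \<epsilon> by (simp add: power_le_one)
        then show "(1 + (\<epsilon> * u)\<^sup>2) ^ N \<le> (1 + u\<^sup>2) ^ N"
          by (intro power_mono) (auto simp: power_mult_distrib mult_left_le_one_le)
        show "K * (\<epsilon> * u) ^ 4 \<le> \<bar>K\<bar> * (\<epsilon> * u) ^ 4"
          by (rule mult_right_mono) auto
      qed auto
      have "G u - poly T u * exp (- u\<^sup>2) = u ^ k * exp (- u\<^sup>2) * (wroot (\<epsilon> * u) * sroot (\<epsilon> * u) powr b
          - (1 + b / 2 * (\<epsilon> * u) + (b\<^sup>2 - 1) / 8 * (\<epsilon> * u)\<^sup>2 + (b ^ 3 / 48 - b / 12) * (\<epsilon> * u) ^ 3))"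
        unfolding T G_def by (simp only: right_diff_distrib mult_ac)
      then have "\<bar>G u - poly T u * exp (- u\<^sup>2)\<bar>
          \<le> \<bar>u ^ k * exp (- u\<^sup>2)\<bar> * (K * (\<epsilon> * u) ^ 4 * (1 + (\<epsilon> * u)\<^sup>2) ^ N)"
        using KN[of "\<epsilon> * u"] by (simp only: abs_mult) (rule mult_left_mono, auto)
      also have "\<dots> \<le> \<bar>u ^ k * exp (- u\<^sup>2)\<bar> * (\<bar>K\<bar> * (\<epsilon> * u) ^ 4 * (1 + u\<^sup>2) ^ N)"
        by (rule mult_left_mono[OF le]) simp
      finally show ?thesis
        by (simp add: q abs_mult power_mult_distrib mult_ac)
    qed
    have iq: "integrable lborel (\<lambda>u. \<epsilon> ^ 4 * (\<bar>K\<bar> * \<bar>poly q u * exp (- u\<^sup>2)\<bar>))"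
      by (intro integrable_mult_right integrable_abs integrable_gauss)
    \<comment> \<open>Integrability of \<open>G\<close> is not known beforehand; it follows because
      \<open>G\<close> differs from a polynomial times the Gaussian by a dominated function.\<close>
    have iD: "integrable lborel (\<lambda>u. G u - poly T u * exp (- u\<^sup>2))"
      by (rule Bochner_Integration.integrable_bound[OF iq]) (use bound in \<open>auto intro!: AE_I2 order_trans[OF bound]\<close>)
    have iG: "integrable lborel G"
      using Bochner_Integration.integrable_add[OF iD integrable_gauss[of T]] by simp
    have "(LINT u|lborel. G u) - gauss T = (LINT u|lborel. G u - poly T u * exp (- u\<^sup>2))"
      using iG integrable_gauss[of T] by (simp add: gauss_def)
    also have "\<bar>\<dots>\<bar> \<le> (LINT u|lborel. \<epsilon> ^ 4 * (\<bar>K\<bar> * \<bar>poly q u * exp (- u\<^sup>2)\<bar>))"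
      by (rule integral_abs_bound_integral[OF iD iq bound])
    also have "\<dots> = C * \<epsilon> ^ 4"
      by (simp add: C_def)
    finally show ?thesis
      using iG by (simp only: G_def T_def gauss_add gauss_smult mult.assoc)
  qed
  then show ?thesis by blast
qed

text \<open>The Laguerre integral after the substitution, with \<epsilon> = 1 / \<sigma> and without
  its prefactor. The polynomial is taken in the variable (x - \<sigma>^2) / \<sigma>. In the
  exponent, 2 \<alpha> comes from x^\<alpha> and 2 from the Jacobian.\<close>

definition wint :: "real \<Rightarrow> real \<Rightarrow> real poly \<Rightarrow> real" where
  "wint \<alpha> \<epsilon> p = (LINT u|lborel. poly p (u * sroot (\<epsilon> * u)) *
     (wroot (\<epsilon> * u) * sroot (\<epsilon> * u) powr (2 * \<alpha> + 2)) * exp (- u\<^sup>2))"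

text \<open>A monomial of degree k only raises the exponent of \<open>sroot\<close> by k, which
  brings \<open>wint\<close> into the form of \<open>laplace_expansion\<close>.\<close>

lemma monom_wint:
  "poly (monom c k) (u * sroot (\<epsilon> * u)) * (wroot (\<epsilon> * u) * sroot (\<epsilon> * u) powr (2 * \<alpha> + 2)) * exp (- u\<^sup>2)
   = c * (u ^ k * (wroot (\<epsilon> * u) * sroot (\<epsilon> * u) powr (2 * \<alpha> + 2 + real k)) * exp (- u\<^sup>2))"
proof -
  have "sroot (\<epsilon> * u) powr (2 * \<alpha> + 2 + real k) = sroot (\<epsilon> * u) powr (2 * \<alpha> + 2) * sroot (\<epsilon> * u) ^ k"
    using sroot_pos[of "\<epsilon> * u"] by (simp add: powr_add powr_realpow)
  then show ?thesis
    by (simp only: poly_monom power_mult_distrib mult_ac)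
qed

lemma wint_integrable:
  assumes "0 < \<epsilon>" "\<epsilon> \<le> 1"
  shows "integrable lborel (\<lambda>u. poly p (u * sroot (\<epsilon> * u)) *
     (wroot (\<epsilon> * u) * sroot (\<epsilon> * u) powr (2 * \<alpha> + 2)) * exp (- u\<^sup>2))"
proof (induction p rule: poly_monom_induct)
  case (1 c k)
  show ?case
    unfolding monom_wint
    using laplace_expansion[of k "2 * \<alpha> + 2 + real k"] assms by (intro integrable_mult_right) blast
next
  case (2 p q)
  then show ?case by (simp add: distrib_right)
qed

lemma wint_add: "0 < \<epsilon> \<Longrightarrow> \<epsilon> \<le> 1 \<Longrightarrow> wint \<alpha> \<epsilon> (p + q) = wint \<alpha> \<epsilon> p + wint \<alpha> \<epsilon> q"
  by (simp add: wint_def distrib_right wint_integrable)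

lemma wint_smult: "wint \<alpha> \<epsilon> (smult c p) = c * wint \<alpha> \<epsilon> p"
  by (simp add: wint_def mult.assoc)

text \<open>For monomials this is \<open>laplace_expansion\<close>, whose coefficients depend on the
  degree k. Writing them through \<open>pert1\<close>, \<open>pert2\<close> and \<open>pert3\<close>
  makes the formula linear in p, so it extends to all polynomials.\<close>

lemma wint_expansion:
  obtains C where "\<And>\<epsilon>. 0 < \<epsilon> \<Longrightarrow> \<epsilon> \<le> 1 \<Longrightarrow>
    \<bar>wint \<alpha> \<epsilon> p - (gauss p + \<epsilon> * gauss (pert1 \<alpha> * p) + \<epsilon>\<^sup>2 * gauss (pert2 \<alpha> * p)
       + \<epsilon> ^ 3 * gauss (pert3 \<alpha> * p))\<bar> \<le> C * \<epsilon> ^ 4"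
proof -
  have "\<exists>C. \<forall>\<epsilon>. 0 < \<epsilon> \<and> \<epsilon> \<le> 1 \<longrightarrow>
    \<bar>wint \<alpha> \<epsilon> p - (gauss p + \<epsilon> * gauss (pert1 \<alpha> * p) + \<epsilon>\<^sup>2 * gauss (pert2 \<alpha> * p)
       + \<epsilon> ^ 3 * gauss (pert3 \<alpha> * p))\<bar> \<le> C * \<epsilon> ^ 4"
  proof (induction p rule: poly_monom_induct)
    case (1 c k)
    obtain C where C: "\<And>\<epsilon>. 0 < \<epsilon> \<Longrightarrow> \<epsilon> \<le> 1 \<Longrightarrow>
      \<bar>(LINT u|lborel. u ^ k * (wroot (\<epsilon> * u) * sroot (\<epsilon> * u) powr (2 * \<alpha> + 2 + real k)) * exp (- u\<^sup>2))
       - (gauss (monom 1 k) + \<epsilon> * gauss (pert1 \<alpha> * monom 1 k)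
          + \<epsilon>\<^sup>2 * gauss (pert2 \<alpha> * monom 1 k) + \<epsilon> ^ 3 * gauss (pert3 \<alpha> * monom 1 k))\<bar> \<le> C * \<epsilon> ^ 4"
      unfolding gauss_monom_pert1 gauss_monom_pert2 gauss_monom_pert3
      using laplace_expansion[of k "2 * \<alpha> + 2 + real k"] by blast
    have "\<bar>wint \<alpha> \<epsilon> (monom c k) - (gauss (monom c k) + \<epsilon> * gauss (pert1 \<alpha> * monom c k)
        + \<epsilon>\<^sup>2 * gauss (pert2 \<alpha> * monom c k) + \<epsilon> ^ 3 * gauss (pert3 \<alpha> * monom c k))\<bar> \<le> (\<bar>c\<bar> * C) * \<epsilon> ^ 4"
      if "0 < \<epsilon>" "\<epsilon> \<le> 1" for \<epsilon>
    proof -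
      define I where "I = (LINT u|lborel. u ^ k * (wroot (\<epsilon> * u) * sroot (\<epsilon> * u) powr (2 * \<alpha> + 2 + real k)) * exp (- u\<^sup>2))"
      have cm: "monom c k = smult c (monom 1 k)" by (simp add: smult_monom)
      have "wint \<alpha> \<epsilon> (monom c k) = c * I"
        unfolding wint_def monom_wint I_def by simp
      moreover have "\<bar>c\<bar> * \<bar>I - (gauss (monom 1 k) + \<epsilon> * gauss (pert1 \<alpha> * monom 1 k)
          + \<epsilon>\<^sup>2 * gauss (pert2 \<alpha> * monom 1 k) + \<epsilon> ^ 3 * gauss (pert3 \<alpha> * monom 1 k))\<bar> \<le> \<bar>c\<bar> * (C * \<epsilon> ^ 4)"
        using C[OF that] unfolding I_def by (rule mult_left_mono) simp
      ultimately show ?thesis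
        unfolding cm by (simp add: gauss_smult algebra_simps flip: abs_mult)
    qed
    then show ?case by blast
  next
    case (2 p q)
    then obtain C D where CD:
      "\<And>\<epsilon>. 0 < \<epsilon> \<and> \<epsilon> \<le> 1 \<Longrightarrow> \<bar>wint \<alpha> \<epsilon> p - (gauss p + \<epsilon> * gauss (pert1 \<alpha> * p)
         + \<epsilon>\<^sup>2 * gauss (pert2 \<alpha> * p) + \<epsilon> ^ 3 * gauss (pert3 \<alpha> * p))\<bar> \<le> C * \<epsilon> ^ 4"
      "\<And>\<epsilon>. 0 < \<epsilon> \<and> \<epsilon> \<le> 1 \<Longrightarrow> \<bar>wint \<alpha> \<epsilon> q - (gauss q + \<epsilon> * gauss (pert1 \<alpha> * q)
         + \<epsilon>\<^sup>2 * gauss (pert2 \<alpha> * q) + \<epsilon> ^ 3 * gauss (pert3 \<alpha> * q))\<bar> \<le> D * \<epsilon> ^ 4"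
      by blast
    have "\<bar>wint \<alpha> \<epsilon> (p + q) - (gauss (p + q) + \<epsilon> * gauss (pert1 \<alpha> * (p + q))
         + \<epsilon>\<^sup>2 * gauss (pert2 \<alpha> * (p + q)) + \<epsilon> ^ 3 * gauss (pert3 \<alpha> * (p + q)))\<bar> \<le> (C + D) * \<epsilon> ^ 4"
      if "0 < \<epsilon> \<and> \<epsilon> \<le> 1" for \<epsilon>
      using CD[OF that] that unfolding abs_le_iff
      by (simp only: wint_add gauss_add distrib_left distrib_right minus_diff_eq) linarith
    then show ?case by blast
  qed
  then show thesis using that by blast
qed

subsection \<open>Change of variables\<close>

lemma sroot_surj:
  assumes "y > 0"
  shows "sroot (y - 1 / y) = y"
proof -
  have "1 + (y - 1 / y)\<^sup>2 / 4 = ((y + 1 / y) / 2)\<^sup>2"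
    using assms by (simp add: field_simps power2_eq_square)
  then have "sqrt (1 + (y - 1 / y)\<^sup>2 / 4) = (y + 1 / y) / 2"
    using assms by (simp only: real_sqrt_abs) simp
  then show ?thesis
    by (simp add: sroot_def field_simps)
qed

lemma image_sroot_square:
  assumes "\<sigma> > 0"
  shows "(\<lambda>u. (\<sigma> * sroot (u / \<sigma>))\<^sup>2) ` UNIV = {0<..}"
proof -
  have "x \<in> (\<lambda>u. (\<sigma> * sroot (u / \<sigma>))\<^sup>2) ` UNIV" if "x > 0" for x
  proof -
    define y where "y = sqrt x / \<sigma>"
    have "y > 0" using that assms by (simp add: y_def)
    then have "(\<sigma> * sroot (\<sigma> * (y - 1 / y) / \<sigma>))\<^sup>2 = x"
      using that assms by (simp add: sroot_surj) (simp add: y_def)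
    then show ?thesis by (metis rangeI)
  qed
  moreover have "(\<sigma> * sroot (u / \<sigma>))\<^sup>2 > 0" for u
    using assms sroot_pos[of "u / \<sigma>"] by simp
  ultimately show ?thesis by auto
qed

lemma inj_sroot_square:
  assumes "\<sigma> > 0"
  shows "inj (\<lambda>u. (\<sigma> * sroot (u / \<sigma>))\<^sup>2)"
proof (rule injI)
  fix u v assume "(\<sigma> * sroot (u / \<sigma>))\<^sup>2 = (\<sigma> * sroot (v / \<sigma>))\<^sup>2"
  then have "\<sigma> * sroot (u / \<sigma>) = \<sigma> * sroot (v / \<sigma>)"
    using assms sroot_pos[of "u / \<sigma>"] sroot_pos[of "v / \<sigma>"] by (simp add: power2_eq_iff_nonneg)
  then have "sroot (u / \<sigma>) = sroot (v / \<sigma>)" using assms by simp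
  then have "u / \<sigma> = v / \<sigma>" using sroot_diff_inverse by metis
  then show "u = v" using assms by simp
qed

text \<open>With r = \<open>sroot (u / \<sigma>)\<close>, the exponent \<sigma>^2 (r^2 + 1 / r^2)
  equals \<sigma>^2 ((r - 1 / r)^2 + 2) = u^2 + 2 \<sigma>^2, hence an exact Gaussian.\<close>

lemma laguerre_weight_sroot:
  assumes "\<sigma> > 0"
  shows "laguerre_weight \<alpha> (\<sigma> ^ 4) ((\<sigma> * sroot (u / \<sigma>))\<^sup>2)
    = \<sigma> powr (2 * \<alpha>) * exp (- 2 * \<sigma>\<^sup>2) * (sroot (u / \<sigma>) powr (2 * \<alpha>) * exp (- u\<^sup>2))"
proof -
  define r where "r = sroot (u / \<sigma>)"
  have r: "r > 0" "r - 1 / r = u / \<sigma>"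
    using sroot_pos sroot_diff_inverse by (simp_all add: r_def)
  have u: "u = \<sigma> * (r - 1 / r)" using r assms by simp
  have "(r - 1 / r)\<^sup>2 = r\<^sup>2 - 2 + 1 / r\<^sup>2"
    using r(1) by (simp add: power2_eq_square field_simps)
  moreover have "\<sigma> ^ 4 / (\<sigma> * r)\<^sup>2 = \<sigma>\<^sup>2 * (1 / r\<^sup>2)"
    using r(1) assms by (simp add: power2_eq_square eval_nat_numeral)
  ultimately have "- (\<sigma> * r)\<^sup>2 - \<sigma> ^ 4 / (\<sigma> * r)\<^sup>2 = - 2 * \<sigma>\<^sup>2 - u\<^sup>2"
    unfolding u by (simp only: power_mult_distrib) (simp add: algebra_simps)
  moreover have "(\<sigma> * r)\<^sup>2 powr \<alpha> = \<sigma> powr (2 * \<alpha>) * r powr (2 * \<alpha>)"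
    using r(1) assms by (simp add: powr_mult powr_powr flip: powr_numeral)
  ultimately show ?thesis
    unfolding laguerre_weight_def r_def[symmetric] by (simp add: exp_diff exp_minus divide_inverse)
qed

text \<open>The composition with \<open>[:\<sigma>\<^sup>2, \<sigma>:]\<close> expresses x =
  \<sigma>^2 + \<sigma> v through the centred variable v. The assumption on \<sigma> gives 1 /
  \<sigma> \<le> 1, as needed for integrability on the Gaussian side.\<close>

lemma laguerre_integral_eq_wint:
  assumes \<sigma>: "\<sigma> \<ge> 1"
  shows "set_integrable lborel {0<..} (\<lambda>x. poly p x * laguerre_weight \<alpha> (\<sigma> ^ 4) x)"
    and "(LINT x:{0<..}|lborel. poly p x * laguerre_weight \<alpha> (\<sigma> ^ 4) x)
      = \<sigma> powr (2 * \<alpha> + 1) * exp (- 2 * \<sigma>\<^sup>2) * wint \<alpha> (1 / \<sigma>) (pcompose p [:\<sigma>\<^sup>2, \<sigma>:])"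
proof -
  define f where "f = (\<lambda>x. poly p x * laguerre_weight \<alpha> (\<sigma> ^ 4) x)"
  define g where "g = (\<lambda>u. (\<sigma> * sroot (u / \<sigma>))\<^sup>2)"
  define g' where "g' u = \<sigma> * (sroot (u / \<sigma>))\<^sup>2 * wroot (u / \<sigma>)" for u
  define c where "c = \<sigma> powr (2 * \<alpha> + 1) * exp (- 2 * \<sigma>\<^sup>2)"
  define h where "h u = poly (pcompose p [:\<sigma>\<^sup>2, \<sigma>:]) (u * sroot (1 / \<sigma> * u)) *
     (wroot (1 / \<sigma> * u) * sroot (1 / \<sigma> * u) powr (2 * \<alpha> + 2)) * exp (- u\<^sup>2)" for u
  have \<sigma>0: "\<sigma> > 0" using \<sigma> by simp
  have der: "(g has_real_derivative g' u) (at u within UNIV)" for u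
  proof -
    have "((\<lambda>u. sroot (u / \<sigma>)) has_real_derivative (sroot (u / \<sigma>) * wroot (u / \<sigma>) / 2) * (1 / \<sigma>)) (at u)"
      by (rule DERIV_chain2[where f = sroot and g = "\<lambda>u. u / \<sigma>", OF has_real_derivative_sroot])
        (rule DERIV_cdivide[OF DERIV_ident])
    from DERIV_power[OF DERIV_cmult[OF this, of \<sigma>], of 2] show ?thesis
      unfolding g_def g'_def using \<sigma>0 by (simp add: power2_eq_square mult_ac)
  qed
  have subst: "\<bar>g' u\<bar> * f (g u) = c * h u" for u
  proof -
    define r where "r = sroot (u / \<sigma>)"
    have r: "r > 0" "r - 1 / r = u / \<sigma>"
      using sroot_pos sroot_diff_inverse by (simp_all add: r_def)
    \<comment> \<open>The defining equation of \<open>sroot\<close> is what shows that x -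
      \<sigma>^2 is \<sigma> u r.\<close>
    then have "r\<^sup>2 = 1 + u / \<sigma> * r"
      by (simp add: field_simps power2_eq_square)
    then have arg: "(\<sigma> * r)\<^sup>2 = \<sigma>\<^sup>2 + \<sigma> * (u * r)"
      using \<sigma>0 by (simp add: power_mult_distrib) (simp add: power2_eq_square field_simps)
    have "\<bar>g' u\<bar> = \<sigma> * r\<^sup>2 * wroot (u / \<sigma>)"
      using \<sigma>0 wroot_pos[of "u / \<sigma>"] by (simp add: g'_def r_def abs_mult)
    moreover have "f (g u) = poly p (\<sigma>\<^sup>2 + \<sigma> * (u * r))
        * (\<sigma> powr (2 * \<alpha>) * exp (- 2 * \<sigma>\<^sup>2) * (r powr (2 * \<alpha>) * exp (- u\<^sup>2)))"
      unfolding f_def g_def laguerre_weight_sroot[OF \<sigma>0] by (simp only: r_def[symmetric] arg)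
    moreover have "r powr (2 * \<alpha> + 2) = r powr (2 * \<alpha>) * r\<^sup>2"
      "\<sigma> powr (2 * \<alpha> + 1) = \<sigma> powr (2 * \<alpha>) * \<sigma>"
      using r \<sigma>0 by (simp_all add: powr_add)
    ultimately show ?thesis
      by (simp add: c_def h_def r_def[symmetric] poly_pcompose mult_ac)
  qed
  have ih: "integrable lborel h"
    unfolding h_def [abs_def] by (rule wint_integrable) (use \<sigma> in simp_all)
  then have ich: "integrable lborel (\<lambda>u. c * h u)" by simp
  \<comment> \<open>Integrability and value are prepared together, since the change of variables
    carries both from the real line to the positive half-line at once.\<close>
  have "(\<lambda>u. \<bar>g' u\<bar> * f (g u)) absolutely_integrable_on UNIV
      \<and> integral UNIV (\<lambda>u. \<bar>g' u\<bar> * f (g u)) = c * (LINT u|lborel. h u)"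
  proof
    show "(\<lambda>u. \<bar>g' u\<bar> * f (g u)) absolutely_integrable_on UNIV"
      using ich integrable_completion[OF borel_measurable_integrable[OF ich]]
      by (simp only: subst set_integrable_def) simp
    show "integral UNIV (\<lambda>u. \<bar>g' u\<bar> * f (g u)) = c * (LINT u|lborel. h u)"
      using integral_lborel[OF ich] by (simp add: subst)
  qed
  moreover have "g ` UNIV = {0<..}" "inj g"
    using image_sroot_square[OF \<sigma>0] inj_sroot_square[OF \<sigma>0] by (simp_all add: g_def)
  ultimately have *: "f absolutely_integrable_on {0<..}" "integral {0<..} f = c * (LINT u|lborel. h u)"
    using has_absolute_integral_change_of_variables_1'[of UNIV g g' f "c * (LINT u|lborel. h u)", OF _ der]
    by simp_all
  \<comment> \<open>Absolute integrability refers to the completed measure; Borel measurability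
    brings it back to \<open>lborel\<close>.\<close>
  have "set_borel_measurable lborel {0<..} f"
    unfolding f_def laguerre_weight_def set_borel_measurable_def by measurable
  then show "set_integrable lborel {0<..} (\<lambda>x. poly p x * laguerre_weight \<alpha> (\<sigma> ^ 4) x)"
    using *(1) by (simp add: f_def set_integrable_def set_borel_measurable_def integrable_completion)
  then have "(LINT x:{0<..}|lborel. f x) = integral {0<..} f"
    unfolding f_def by (rule set_borel_integral_eq_integral)
  also have "\<dots> = c * wint \<alpha> (1 / \<sigma>) (pcompose p [:\<sigma>\<^sup>2, \<sigma>:])"
    unfolding *(2) wint_def h_def ..
  finally show "(LINT x:{0<..}|lborel. poly p x * laguerre_weight \<alpha> (\<sigma> ^ 4) x)
      = \<sigma> powr (2 * \<alpha> + 1) * exp (- 2 * \<sigma>\<^sup>2) * wint \<alpha> (1 / \<sigma>) (pcompose p [:\<sigma>\<^sup>2, \<sigma>:])"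
    by (simp add: f_def c_def)
qed

lemma wint_0: "wint \<alpha> \<epsilon> 0 = 0"
  by (simp add: wint_def)

lemma wint_sum:
  assumes "0 < \<epsilon>" "\<epsilon> \<le> 1"
  shows "wint \<alpha> \<epsilon> (\<Sum>k\<in>A. f k) = (\<Sum>k\<in>A. wint \<alpha> \<epsilon> (f k))"
  using assms by (induction A rule: infinite_finite_induct) (simp_all add: wint_0 wint_add)

text \<open>For \<epsilon> \<le> 1 the higher terms are absorbed into the error. The constant is
  chosen nonnegative so that such bounds can be multiplied and added later; the next lemma truncates
  once more.\<close>

lemma wint_expansion_2:
  "\<exists>C\<ge>0. \<forall>\<epsilon>. 0 < \<epsilon> \<and> \<epsilon> \<le> 1 \<longrightarrow>
    \<bar>wint \<alpha> \<epsilon> p - (gauss p + \<epsilon> * gauss (pert1 \<alpha> * p))\<bar> \<le> C * \<epsilon>\<^sup>2"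
proof -
  obtain C where C: "\<And>\<epsilon>. 0 < \<epsilon> \<Longrightarrow> \<epsilon> \<le> 1 \<Longrightarrow>
    \<bar>wint \<alpha> \<epsilon> p - (gauss p + \<epsilon> * gauss (pert1 \<alpha> * p) + \<epsilon>\<^sup>2 * gauss (pert2 \<alpha> * p)
       + \<epsilon> ^ 3 * gauss (pert3 \<alpha> * p))\<bar> \<le> C * \<epsilon> ^ 4"
    using wint_expansion by blast
  have "\<bar>wint \<alpha> \<epsilon> p - (gauss p + \<epsilon> * gauss (pert1 \<alpha> * p))\<bar>
      \<le> (\<bar>C\<bar> + \<bar>gauss (pert2 \<alpha> * p)\<bar> + \<bar>gauss (pert3 \<alpha> * p)\<bar>) * \<epsilon>\<^sup>2"
    if \<epsilon>: "0 < \<epsilon> \<and> \<epsilon> \<le> 1" for \<epsilon>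
  proof -
    define a where "a = gauss (pert2 \<alpha> * p)"
    define b where "b = gauss (pert3 \<alpha> * p)"
    have "\<bar>wint \<alpha> \<epsilon> p - (gauss p + \<epsilon> * gauss (pert1 \<alpha> * p))\<bar> \<le> C * \<epsilon> ^ 4 + \<bar>\<epsilon>\<^sup>2 * a\<bar> + \<bar>\<epsilon> ^ 3 * b\<bar>"
      using C[of \<epsilon>] \<epsilon> unfolding a_def[symmetric] b_def[symmetric] by linarith
    also have "C * \<epsilon> ^ 4 \<le> \<bar>C\<bar> * \<epsilon>\<^sup>2"
      using \<epsilon> by (intro mult_mono power_decreasing) auto
    also have "\<bar>\<epsilon> ^ 3 * b\<bar> \<le> \<epsilon>\<^sup>2 * \<bar>b\<bar>"
      using \<epsilon> by (simp add: abs_mult) (intro mult_right_mono power_decreasing, auto)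
    finally show ?thesis
      unfolding a_def[symmetric] b_def[symmetric] by (simp add: abs_mult algebra_simps)
  qed
  moreover have "\<bar>C\<bar> + \<bar>gauss (pert2 \<alpha> * p)\<bar> + \<bar>gauss (pert3 \<alpha> * p)\<bar> \<ge> 0" by simp
  ultimately show ?thesis by blast
qed

lemma wint_expansion_1:
  "\<exists>C\<ge>0. \<forall>\<epsilon>. 0 < \<epsilon> \<and> \<epsilon> \<le> 1 \<longrightarrow> \<bar>wint \<alpha> \<epsilon> p - gauss p\<bar> \<le> C * \<epsilon>"
proof -
  obtain C where C: "C \<ge> 0" "\<And>\<epsilon>. 0 < \<epsilon> \<and> \<epsilon> \<le> 1 \<Longrightarrow>
    \<bar>wint \<alpha> \<epsilon> p - (gauss p + \<epsilon> * gauss (pert1 \<alpha> * p))\<bar> \<le> C * \<epsilon>\<^sup>2"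
    using wint_expansion_2 by blast
  have "\<bar>wint \<alpha> \<epsilon> p - gauss p\<bar> \<le> (C + \<bar>gauss (pert1 \<alpha> * p)\<bar>) * \<epsilon>" if \<epsilon>: "0 < \<epsilon> \<and> \<epsilon> \<le> 1" for \<epsilon>
  proof -
    have "\<bar>wint \<alpha> \<epsilon> p - gauss p\<bar> \<le> C * \<epsilon>\<^sup>2 + \<bar>\<epsilon> * gauss (pert1 \<alpha> * p)\<bar>"
      using C(2)[OF \<epsilon>] by linarith
    also have "C * \<epsilon>\<^sup>2 \<le> C * \<epsilon>"
      using C(1) \<epsilon> by (intro mult_left_mono) (auto simp: power2_eq_square mult_left_le)
    finally show ?thesis using \<epsilon> by (simp add: abs_mult algebra_simps)
  qed
  moreover have "C + \<bar>gauss (pert1 \<alpha> * p)\<bar> \<ge> 0" using C(1) by simp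
  ultimately show ?thesis by blast
qed

subsection \<open>The norm of the trial polynomial\<close>

definition trial :: "real \<Rightarrow> real \<Rightarrow> nat \<Rightarrow> real poly" where
  "trial \<alpha> \<epsilon> n = herm n + smult \<epsilon> (corr \<alpha> n)"

text \<open>Order zero vanishes by Hermite orthogonality and order one by
  \<open>gauss_first_order\<close>. For the \<open>corr\<close> part a bound of order \<epsilon>
  suffices, as it enters with a factor \<epsilon>.\<close>

lemma wint_trial_mult:
  assumes "degree r < n"
  shows "\<exists>C\<ge>0. \<forall>\<epsilon>. 0 < \<epsilon> \<and> \<epsilon> \<le> 1 \<longrightarrow> \<bar>wint \<alpha> \<epsilon> (trial \<alpha> \<epsilon> n * r)\<bar> \<le> C * \<epsilon>\<^sup>2"
proof -
  obtain C where C: "C \<ge> 0" "\<And>\<epsilon>. 0 < \<epsilon> \<and> \<epsilon> \<le> 1 \<Longrightarrow>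
    \<bar>wint \<alpha> \<epsilon> (herm n * r) - (gauss (herm n * r) + \<epsilon> * gauss (pert1 \<alpha> * (herm n * r)))\<bar> \<le> C * \<epsilon>\<^sup>2"
    using wint_expansion_2 by blast
  obtain D where D: "D \<ge> 0" "\<And>\<epsilon>. 0 < \<epsilon> \<and> \<epsilon> \<le> 1 \<Longrightarrow>
    \<bar>wint \<alpha> \<epsilon> (corr \<alpha> n * r) - gauss (corr \<alpha> n * r)\<bar> \<le> D * \<epsilon>"
    using wint_expansion_1 by blast
  have "\<bar>wint \<alpha> \<epsilon> (trial \<alpha> \<epsilon> n * r)\<bar> \<le> (C + D) * \<epsilon>\<^sup>2" if \<epsilon>: "0 < \<epsilon> \<and> \<epsilon> \<le> 1" for \<epsilon>
  proof -
    define x where "x = wint \<alpha> \<epsilon> (herm n * r)"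
    define y where "y = wint \<alpha> \<epsilon> (corr \<alpha> n * r)"
    define c where "c = gauss (corr \<alpha> n * r)"
    have "gauss (pert1 \<alpha> * (herm n * r)) = - c" "gauss (herm n * r) = 0"
      using gauss_first_order[OF assms, of \<alpha>] gauss_herm_mult_eq_0[OF assms] by (simp_all add: c_def)
    then have x: "\<bar>x + \<epsilon> * c\<bar> \<le> C * \<epsilon>\<^sup>2"
      using C(2)[OF \<epsilon>] by (simp add: x_def)
    have "\<epsilon> * \<bar>y - c\<bar> \<le> \<epsilon> * (D * \<epsilon>)"
      using D(2)[OF \<epsilon>] \<epsilon> by (intro mult_left_mono) (auto simp: y_def c_def)
    then have y: "\<bar>\<epsilon> * y - \<epsilon> * c\<bar> \<le> D * \<epsilon>\<^sup>2"
      using \<epsilon> by (simp add: abs_mult power2_eq_square mult_ac flip: right_diff_distrib)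
    have "wint \<alpha> \<epsilon> (trial \<alpha> \<epsilon> n * r) = x + \<epsilon> * y"
      using \<epsilon> by (simp add: trial_def distrib_right wint_add wint_smult x_def y_def)
    then show ?thesis
      using x y unfolding distrib_right by linarith
  qed
  moreover have "C + D \<ge> 0" using C(1) D(1) by simp
  ultimately show ?thesis by blast
qed

text \<open>\<open>corr\<close> combines the degrees n - 1 and n - 3, so its parity is opposite to
  that of \<open>herm n\<close>; where the subtraction truncates, the coefficient is zero.\<close>

lemma poly_corr_minus: "poly (corr \<alpha> n) (- u) = - ((- 1) ^ n * poly (corr \<alpha> n) u)"
proof -
  have "poly (- (smult a (herm (n - 1)) + smult b (herm (n - 3)))) (- u)
      = - ((- 1) ^ n * poly (- (smult a (herm (n - 1)) + smult b (herm (n - 3)))) u)"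
    if "n < 1 \<Longrightarrow> a = 0" "n < 3 \<Longrightarrow> b = 0" for a b
    using that
    by (cases rule: nat_cases_012[of n])
      (simp_all add: poly_herm_minus algebra_simps numeral_2_eq_2 numeral_3_eq_3 del: herm.simps)
  then show ?thesis
    unfolding corr_def by (rule, auto simp: less_Suc_eq numeral_3_eq_3)
qed

text \<open>The square is H + 2 \<epsilon> R + \<epsilon>^2 S, so S is needed only up to order
  \<epsilon>^2. All contributions at orders \<epsilon> and \<epsilon>^3 are integrals of odd
  functions, and \<open>gauss_second_order\<close> evaluates order \<epsilon>^2.\<close>

lemma wint_trial_square:
  "\<exists>C. \<forall>\<epsilon>. 0 < \<epsilon> \<and> \<epsilon> \<le> 1 \<longrightarrow>
    \<bar>wint \<alpha> \<epsilon> (trial \<alpha> \<epsilon> n * trial \<alpha> \<epsilon> n)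
     - herm_norm n * (1 + (2 * \<alpha> + 2 * real n + 1) * (2 * \<alpha> + 6 * real n + 3) / 16 * \<epsilon>\<^sup>2)\<bar> \<le> C * \<epsilon> ^ 4"
proof -
  define c where "c = (2 * \<alpha> + 2 * real n + 1) * (2 * \<alpha> + 6 * real n + 3) / 16"
  define H where "H = herm n * herm n"
  define R where "R = herm n * corr \<alpha> n"
  define S where "S = corr \<alpha> n * corr \<alpha> n"
  obtain C1 where C1: "\<And>\<epsilon>. 0 < \<epsilon> \<Longrightarrow> \<epsilon> \<le> 1 \<Longrightarrow>
    \<bar>wint \<alpha> \<epsilon> H - (gauss H + \<epsilon> * gauss (pert1 \<alpha> * H) + \<epsilon>\<^sup>2 * gauss (pert2 \<alpha> * H)
       + \<epsilon> ^ 3 * gauss (pert3 \<alpha> * H))\<bar> \<le> C1 * \<epsilon> ^ 4"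
    using wint_expansion by blast
  obtain C2 where C2: "\<And>\<epsilon>. 0 < \<epsilon> \<Longrightarrow> \<epsilon> \<le> 1 \<Longrightarrow>
    \<bar>wint \<alpha> \<epsilon> R - (gauss R + \<epsilon> * gauss (pert1 \<alpha> * R) + \<epsilon>\<^sup>2 * gauss (pert2 \<alpha> * R)
       + \<epsilon> ^ 3 * gauss (pert3 \<alpha> * R))\<bar> \<le> C2 * \<epsilon> ^ 4"
    using wint_expansion by blast
  obtain C3 where C3: "C3 \<ge> 0" "\<And>\<epsilon>. 0 < \<epsilon> \<and> \<epsilon> \<le> 1 \<Longrightarrow>
    \<bar>wint \<alpha> \<epsilon> S - (gauss S + \<epsilon> * gauss (pert1 \<alpha> * S))\<bar> \<le> C3 * \<epsilon>\<^sup>2"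
    using wint_expansion_2 by blast
  have sq1: "(- 1) ^ n * ((- 1) ^ n * z) = (z :: real)" for z
    by (simp flip: mult.assoc power_mult_distrib)
  have pertm: "poly (pert1 \<alpha>) (- u) = - poly (pert1 \<alpha>) u" "poly (pert2 \<alpha>) (- u) = poly (pert2 \<alpha>) u"
    "poly (pert3 \<alpha>) (- u) = - poly (pert3 \<alpha>) u" for u
    by (simp_all add: pert1_def pert2_def pert3_def poly_monom)
  have HRS: "poly H (- u) = poly H u" "poly R (- u) = - poly R u" "poly S (- u) = poly S u" for u
    by (simp_all add: H_def R_def S_def poly_herm_minus poly_corr_minus sq1 mult_ac)
  \<comment> \<open>\<open>H\<close> and \<open>S\<close> are even and \<open>R\<close> is odd,
    while \<open>pert1\<close> and \<open>pert3\<close> are odd and \<open>pert2\<close> is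
    even.\<close>
  have odd: "gauss (pert1 \<alpha> * H) = 0" "gauss (pert3 \<alpha> * H) = 0" "gauss R = 0" "gauss (pert2 \<alpha> * R) = 0"
    "gauss (pert1 \<alpha> * S) = 0"
    by (rule gauss_odd; simp add: pertm HRS)+
  have H: "gauss H = herm_norm n" by (simp add: H_def gauss_herm_herm)
  have second: "gauss (pert2 \<alpha> * H) + 2 * gauss (pert1 \<alpha> * R) + gauss S = herm_norm n * c"
    using gauss_second_order[of \<alpha> n] by (simp add: H_def R_def S_def c_def)
  define K where "K = C1 + 2 * \<bar>C2\<bar> + 2 * \<bar>gauss (pert3 \<alpha> * R)\<bar> + C3"
  have "\<bar>wint \<alpha> \<epsilon> (trial \<alpha> \<epsilon> n * trial \<alpha> \<epsilon> n) - herm_norm n * (1 + c * \<epsilon>\<^sup>2)\<bar> \<le> K * \<epsilon> ^ 4"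
    if \<epsilon>: "0 < \<epsilon> \<and> \<epsilon> \<le> 1" for \<epsilon>
  proof -
    define e1 where "e1 = wint \<alpha> \<epsilon> H - (herm_norm n + \<epsilon>\<^sup>2 * gauss (pert2 \<alpha> * H))"
    define e2 where "e2 = wint \<alpha> \<epsilon> R - (\<epsilon> * gauss (pert1 \<alpha> * R) + \<epsilon> ^ 3 * gauss (pert3 \<alpha> * R))"
    define e3 where "e3 = wint \<alpha> \<epsilon> S - gauss S"
    have e1: "\<bar>e1\<bar> \<le> C1 * \<epsilon> ^ 4"
      using C1[of \<epsilon>] \<epsilon> by (simp add: e1_def odd H)
    have "\<bar>2 * \<epsilon> * e2\<bar> = 2 * \<epsilon> * \<bar>e2\<bar>" using \<epsilon> by (simp add: abs_mult)
    also have "\<dots> \<le> 2 * 1 * (\<bar>C2\<bar> * \<epsilon> ^ 4)"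
    proof (rule mult_mono)
      have "\<bar>e2\<bar> \<le> C2 * \<epsilon> ^ 4" using C2[of \<epsilon>] \<epsilon> by (simp add: e2_def odd)
      also have "\<dots> \<le> \<bar>C2\<bar> * \<epsilon> ^ 4" by (rule mult_right_mono) auto
      finally show "\<bar>e2\<bar> \<le> \<bar>C2\<bar> * \<epsilon> ^ 4" .
    qed (use \<epsilon> in auto)
    finally have e2: "\<bar>2 * \<epsilon> * e2\<bar> \<le> 2 * \<bar>C2\<bar> * \<epsilon> ^ 4" by simp
    have "\<bar>\<epsilon>\<^sup>2 * e3\<bar> = \<epsilon>\<^sup>2 * \<bar>e3\<bar>" by (simp add: abs_mult)
    also have "\<dots> \<le> \<epsilon>\<^sup>2 * (C3 * \<epsilon>\<^sup>2)"
      using C3(2)[OF \<epsilon>] by (intro mult_left_mono) (simp_all add: e3_def odd)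
    finally have e3: "\<bar>\<epsilon>\<^sup>2 * e3\<bar> \<le> C3 * \<epsilon> ^ 4" by (simp add: power_even_eq[of _ 2] power2_eq_square mult_ac eval_nat_numeral)
    have "trial \<alpha> \<epsilon> n * trial \<alpha> \<epsilon> n = H + smult (2 * \<epsilon>) R + smult (\<epsilon>\<^sup>2) S"
      by (simp add: trial_def H_def R_def S_def algebra_simps power2_eq_square fun_eq_iff
          flip: poly_eq_poly_eq_iff)
    then have "wint \<alpha> \<epsilon> (trial \<alpha> \<epsilon> n * trial \<alpha> \<epsilon> n) = wint \<alpha> \<epsilon> H + 2 * \<epsilon> * wint \<alpha> \<epsilon> R + \<epsilon>\<^sup>2 * wint \<alpha> \<epsilon> S"
      using \<epsilon> by (simp add: wint_add wint_smult)
    also have "\<dots> - herm_norm n * (1 + c * \<epsilon>\<^sup>2)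
        = e1 + 2 * \<epsilon> * e2 + \<epsilon>\<^sup>2 * e3 + 2 * gauss (pert3 \<alpha> * R) * \<epsilon> ^ 4
          + \<epsilon>\<^sup>2 * (gauss (pert2 \<alpha> * H) + 2 * gauss (pert1 \<alpha> * R) + gauss S - herm_norm n * c)"
      by (simp add: e1_def e2_def e3_def algebra_simps eval_nat_numeral)
    also have "\<dots> = e1 + 2 * \<epsilon> * e2 + \<epsilon>\<^sup>2 * e3 + 2 * gauss (pert3 \<alpha> * R) * \<epsilon> ^ 4"
      using second by simp
    also have "\<bar>\<dots>\<bar> \<le> K * \<epsilon> ^ 4"
    proof -
      have "\<bar>2 * gauss (pert3 \<alpha> * R) * \<epsilon> ^ 4\<bar> = 2 * \<bar>gauss (pert3 \<alpha> * R)\<bar> * \<epsilon> ^ 4"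
        by (simp add: abs_mult)
      then show ?thesis
        using e1 e2 e3 unfolding K_def distrib_right by linarith
    qed
    finally show ?thesis .
  qed
  then show ?thesis unfolding c_def by blast
qed

subsection \<open>Comparison with the orthogonal polynomial\<close>

text \<open>Coercivity, uniform in \<epsilon>: the Gram matrix of the Hermite basis is diagonal up
  to entries of order \<epsilon>, so for small \<epsilon> half of the lower bound from the diagonal
  survives.\<close>

lemma wint_square_lower_bound:
  "\<exists>B>0. \<exists>\<epsilon>0>0. \<forall>\<epsilon> d. 0 < \<epsilon> \<and> \<epsilon> \<le> 1 \<and> \<epsilon> \<le> \<epsilon>0 \<longrightarrow>
    B * (\<Sum>k<n. \<bar>d k\<bar>)\<^sup>2 \<le> wint \<alpha> \<epsilon> ((\<Sum>k<n. smult (d k) (herm k)) * (\<Sum>k<n. smult (d k) (herm k)))"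
proof -
  have "\<forall>j k. \<exists>C\<ge>0. (\<forall>\<epsilon>. 0 < \<epsilon> \<and> \<epsilon> \<le> 1 \<longrightarrow>
      \<bar>wint \<alpha> \<epsilon> (herm j * herm k) - gauss (herm j * herm k)\<bar> \<le> C * \<epsilon>)"
    by (intro allI wint_expansion_1)
  then obtain C where C: "\<And>j k. C j k \<ge> 0" "\<And>j k \<epsilon>. 0 < \<epsilon> \<and> \<epsilon> \<le> 1 \<Longrightarrow>
      \<bar>wint \<alpha> \<epsilon> (herm j * herm k) - gauss (herm j * herm k)\<bar> \<le> C j k * \<epsilon>"
    by metis
  define E where "E = 1 + (\<Sum>j<n. \<Sum>k<n. C j k)"
  have CE: "C j k \<le> E" if "j < n" "k < n" for j k
  proof -
    have "C j k \<le> (\<Sum>k<n. C j k)"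
      using that C(1) by (intro member_le_sum) auto
    also have "\<dots> \<le> (\<Sum>j<n. \<Sum>k<n. C j k)"
      using that C(1) by (intro member_le_sum[where f = "\<lambda>j. \<Sum>k<n. C j k"] sum_nonneg) auto
    finally show ?thesis by (simp add: E_def)
  qed
  have E: "E > 0" using C(1) by (simp add: E_def add_pos_nonneg sum_nonneg)
  \<comment> \<open>Inserting 1 keeps the set nonempty when n = 0.\<close>
  define \<gamma> where "\<gamma> = Min (insert 1 (herm_norm ` {..<n}))"
  have \<gamma>: "\<gamma> > 0" "\<And>k. k < n \<Longrightarrow> \<gamma> \<le> herm_norm k"
    by (auto simp: \<gamma>_def herm_norm_pos)
  \<comment> \<open>Cauchy-Schwarz yields the bound 2 B on the diagonal part, and the perturbation
    costs at most one B because E \<epsilon> \<le> B. The summand 1 avoids division by zero.\<close>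
  define B where "B = \<gamma> / (2 * (real n + 1))"
  have B: "B > 0" using \<gamma> by (simp add: B_def)
  have "B * (\<Sum>k<n. \<bar>d k\<bar>)\<^sup>2
      \<le> wint \<alpha> \<epsilon> ((\<Sum>k<n. smult (d k) (herm k)) * (\<Sum>k<n. smult (d k) (herm k)))"
    if \<epsilon>: "0 < \<epsilon> \<and> \<epsilon> \<le> 1" "\<epsilon> \<le> B / E" for \<epsilon> d
  proof -
    define T where "T = (\<Sum>k<n. \<bar>d k\<bar>)"
    have "T\<^sup>2 \<le> (\<Sum>k<n. \<bar>d k\<bar>\<^sup>2) * (\<Sum>k<n. 1\<^sup>2)"
      using Cauchy_Schwarz_ineq_sum[of "\<lambda>k. \<bar>d k\<bar>" "\<lambda>k. 1" "{..<n}"] by (simp add: T_def)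
    also have "\<dots> \<le> (\<Sum>k<n. (d k)\<^sup>2) * (real n + 1)"
      by (simp add: sum_nonneg mult_left_mono)
    finally have "\<gamma> / (real n + 1) * T\<^sup>2 \<le> \<gamma> / (real n + 1) * ((\<Sum>k<n. (d k)\<^sup>2) * (real n + 1))"
      using \<gamma>(1) by (intro mult_left_mono) auto
    moreover have "2 * B = \<gamma> / (real n + 1)"
      unfolding B_def by (simp only: times_divide_eq_right mult_divide_mult_cancel_left_if) simp
    moreover have "\<gamma> / (real n + 1) * ((\<Sum>k<n. (d k)\<^sup>2) * (real n + 1)) = \<gamma> * (\<Sum>k<n. (d k)\<^sup>2)"
      by (simp add: add_pos_nonneg)
    ultimately have T2: "2 * B * T\<^sup>2 \<le> \<gamma> * (\<Sum>k<n. (d k)\<^sup>2)"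
      by simp
    have EB: "E * \<epsilon> \<le> B" using \<epsilon>(2) E by (simp add: field_simps)
    have "wint \<alpha> \<epsilon> ((\<Sum>k<n. smult (d k) (herm k)) * (\<Sum>k<n. smult (d k) (herm k)))
        = (\<Sum>j<n. \<Sum>k<n. d j * d k * wint \<alpha> \<epsilon> (herm j * herm k))"
      using \<epsilon>(1) by (simp add: sum_product wint_sum wint_smult mult_ac)
    also have "\<dots> \<ge> (\<Sum>j<n. \<Sum>k<n. d j * d k * gauss (herm j * herm k) - \<bar>d j\<bar> * \<bar>d k\<bar> * B)"
    proof (intro sum_mono)
      fix j k assume jk: "j \<in> {..<n}" "k \<in> {..<n}"
      define D where "D = wint \<alpha> \<epsilon> (herm j * herm k) - gauss (herm j * herm k)"
      have "\<bar>D\<bar> \<le> C j k * \<epsilon>" using C(2)[OF \<epsilon>(1)] by (simp add: D_def)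
      also have "\<dots> \<le> E * \<epsilon>" using CE jk \<epsilon>(1) by (intro mult_right_mono) auto
      finally have "\<bar>D\<bar> \<le> B" using EB by simp
      then have "\<bar>d j\<bar> * \<bar>d k\<bar> * \<bar>D\<bar> \<le> \<bar>d j\<bar> * \<bar>d k\<bar> * B"
        by (intro mult_left_mono) auto
      then have "- (d j * d k * D) \<le> \<bar>d j\<bar> * \<bar>d k\<bar> * B"
        by (metis abs_ge_minus_self abs_mult order_trans)
      then show "d j * d k * gauss (herm j * herm k) - \<bar>d j\<bar> * \<bar>d k\<bar> * B
          \<le> d j * d k * wint \<alpha> \<epsilon> (herm j * herm k)"
        by (simp add: D_def algebra_simps)
    qed
    also have "(\<Sum>j<n. \<Sum>k<n. d j * d k * gauss (herm j * herm k) - \<bar>d j\<bar> * \<bar>d k\<bar> * B)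
        = (\<Sum>j<n. (d j)\<^sup>2 * herm_norm j) - B * T\<^sup>2"
      by (simp add: sum_subtractf gauss_herm_herm T_def power2_eq_square sum_product sum_distrib_left
          if_distrib[of "(*) _"] mult_ac cong: if_cong)
    finally have "(\<Sum>j<n. (d j)\<^sup>2 * herm_norm j) - B * T\<^sup>2
      \<le> wint \<alpha> \<epsilon> ((\<Sum>k<n. smult (d k) (herm k)) * (\<Sum>k<n. smult (d k) (herm k)))" .
    moreover have "(\<Sum>j<n. (d j)\<^sup>2 * herm_norm j) \<ge> \<gamma> * (\<Sum>k<n. (d k)\<^sup>2)"
      unfolding sum_distrib_left using \<gamma> by (intro sum_mono) (simp add: mult.commute[of _ "herm_norm _"] mult_right_mono)
    ultimately show ?thesis using T2 unfolding T_def[symmetric] by linarith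
  qed
  moreover have "B / E > 0" using B E by simp
  ultimately show ?thesis using B by blast
qed

lemma wint_square_nonneg: "wint \<alpha> \<epsilon> (p * p) \<ge> 0"
  unfolding wint_def using wroot_pos by (intro integral_nonneg_AE AE_I2) (simp add: less_imp_le)

text \<open>The difference d of trial and orthogonal polynomial has degree below n, so by Pythagoras
  the two squared norms differ by that of d. With T the sum of the absolute Hermite coefficients of
  d, this excess is at least B T^2 and, being the pairing of the trial polynomial with d, at most A
  \<epsilon>^2 T. Hence T is of order \<epsilon>^2 and the excess of order \<epsilon>^4.\<close>

lemma wint_monic_orthogonal_norm:
  assumes monic: "\<And>\<epsilon>. 0 < \<epsilon> \<Longrightarrow> \<epsilon> \<le> 1 \<Longrightarrow> degree (Q \<epsilon>) = n \<and> lead_coeff (Q \<epsilon>) = 1"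
    and orth: "\<And>\<epsilon> r. 0 < \<epsilon> \<Longrightarrow> \<epsilon> \<le> 1 \<Longrightarrow> (\<And>i. i \<ge> n \<Longrightarrow> coeff r i = 0) \<Longrightarrow> wint \<alpha> \<epsilon> (Q \<epsilon> * r) = 0"
  shows "\<exists>C. \<exists>\<epsilon>0>0. \<forall>\<epsilon>. 0 < \<epsilon> \<and> \<epsilon> \<le> \<epsilon>0 \<longrightarrow> \<bar>wint \<alpha> \<epsilon> (Q \<epsilon> * Q \<epsilon>)
     - herm_norm n * (1 + (2 * \<alpha> + 2 * real n + 1) * (2 * \<alpha> + 6 * real n + 3) / 16 * \<epsilon>\<^sup>2)\<bar> \<le> C * \<epsilon> ^ 4"
proof -
  define N where "N \<epsilon> = herm_norm n * (1 + (2 * \<alpha> + 2 * real n + 1) * (2 * \<alpha> + 6 * real n + 3) / 16 * \<epsilon>\<^sup>2)" for \<epsilon>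
  obtain K where K: "\<And>\<epsilon>. 0 < \<epsilon> \<and> \<epsilon> \<le> 1 \<Longrightarrow> \<bar>wint \<alpha> \<epsilon> (trial \<alpha> \<epsilon> n * trial \<alpha> \<epsilon> n) - N \<epsilon>\<bar> \<le> K * \<epsilon> ^ 4"
    using wint_trial_square[of \<alpha> n] unfolding N_def by blast
  obtain B \<epsilon>0 where B: "B > 0" "\<epsilon>0 > 0" "\<And>\<epsilon> d. 0 < \<epsilon> \<and> \<epsilon> \<le> 1 \<and> \<epsilon> \<le> \<epsilon>0 \<Longrightarrow>
    B * (\<Sum>k<n. \<bar>d k\<bar>)\<^sup>2 \<le> wint \<alpha> \<epsilon> ((\<Sum>k<n. smult (d k) (herm k)) * (\<Sum>k<n. smult (d k) (herm k)))"
    using wint_square_lower_bound[of n \<alpha>] by blast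
  have "\<forall>k. \<exists>C. C \<ge> 0 \<and> (k < n \<longrightarrow> (\<forall>\<epsilon>. 0 < \<epsilon> \<and> \<epsilon> \<le> 1 \<longrightarrow> \<bar>wint \<alpha> \<epsilon> (trial \<alpha> \<epsilon> n * herm k)\<bar> \<le> C * \<epsilon>\<^sup>2))"
  proof
    fix k
    show "\<exists>C. C \<ge> 0 \<and> (k < n \<longrightarrow> (\<forall>\<epsilon>. 0 < \<epsilon> \<and> \<epsilon> \<le> 1 \<longrightarrow> \<bar>wint \<alpha> \<epsilon> (trial \<alpha> \<epsilon> n * herm k)\<bar> \<le> C * \<epsilon>\<^sup>2))"
      using wint_trial_mult[of "herm k" n \<alpha>] herm_monic[of k] by (cases "k < n") auto
  qed
  from choice[OF this] obtain A' where A': "\<And>k. A' k \<ge> 0" "\<And>k \<epsilon>. k < n \<Longrightarrow> 0 < \<epsilon> \<and> \<epsilon> \<le> 1 \<Longrightarrow>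
      \<bar>wint \<alpha> \<epsilon> (trial \<alpha> \<epsilon> n * herm k)\<bar> \<le> A' k * \<epsilon>\<^sup>2"
    by blast
  define A where "A = (\<Sum>k<n. A' k)"
  have A: "\<bar>wint \<alpha> \<epsilon> (trial \<alpha> \<epsilon> n * herm k)\<bar> \<le> A * \<epsilon>\<^sup>2" if "k < n" "0 < \<epsilon> \<and> \<epsilon> \<le> 1" for k \<epsilon>
  proof -
    have "A' k \<le> A" unfolding A_def using that A'(1) by (intro member_le_sum) auto
    then show ?thesis using A'(2)[OF that] by (meson mult_right_mono order_trans zero_le_power2)
  qed
  have A0: "A \<ge> 0" unfolding A_def using A'(1) by (simp add: sum_nonneg)
  have "\<bar>wint \<alpha> \<epsilon> (Q \<epsilon> * Q \<epsilon>) - N \<epsilon>\<bar> \<le> (K + A * (A / B)) * \<epsilon> ^ 4" if "0 < \<epsilon> \<and> \<epsilon> \<le> min 1 \<epsilon>0" for \<epsilon>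
  proof -
    have \<epsilon>: "0 < \<epsilon>" "\<epsilon> \<le> 1" "\<epsilon> \<le> \<epsilon>0" using that by auto
    define p where "p = trial \<alpha> \<epsilon> n"
    define d where "d = p - Q \<epsilon>"
    have d: "coeff d i = 0" if "i \<ge> n" for i
    proof -
      have "coeff (herm k) i = 0" if "k < n" for k
        using that \<open>i \<ge> n\<close> herm_monic[of k] by (intro coeff_eq_0) simp
      moreover have "n > 0 \<Longrightarrow> n - 1 < n" "n > 0 \<Longrightarrow> n - 3 < n" by simp_all
      ultimately have "coeff (corr \<alpha> n) i = 0"
        unfolding corr_def by (cases "n = 0") simp_all
      moreover have "coeff (herm n) i = coeff (Q \<epsilon>) i"
        using monic[OF \<epsilon>(1,2)] herm_monic[of n] \<open>i \<ge> n\<close> by (cases "i = n") (auto simp: coeff_eq_0)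
      ultimately show ?thesis by (simp add: d_def p_def trial_def)
    qed
    then obtain c where c: "d = (\<Sum>k<n. smult (c k) (herm k))"
      using monic_basis_expansion[of herm n d] herm_monic by blast
    define T where "T = (\<Sum>k<n. \<bar>c k\<bar>)"
    have T0: "T \<ge> 0" by (simp add: T_def sum_nonneg)
    have Qd: "wint \<alpha> \<epsilon> (Q \<epsilon> * d) = 0" by (rule orth[OF \<epsilon>(1,2) d])
    have p: "p = Q \<epsilon> + d" by (simp add: d_def)
    have "p * p = Q \<epsilon> * Q \<epsilon> + smult 2 (Q \<epsilon> * d) + d * d"
      unfolding p by (simp add: algebra_simps fun_eq_iff flip: poly_eq_poly_eq_iff)
    then have pp: "wint \<alpha> \<epsilon> (p * p) = wint \<alpha> \<epsilon> (Q \<epsilon> * Q \<epsilon>) + wint \<alpha> \<epsilon> (d * d)"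
      using \<epsilon> Qd by (simp add: wint_add wint_smult)
    have "wint \<alpha> \<epsilon> (d * d) = wint \<alpha> \<epsilon> (p * d)"
      using \<epsilon> Qd by (simp add: p distrib_right wint_add)
    also have "\<dots> = (\<Sum>k<n. c k * wint \<alpha> \<epsilon> (p * herm k))"
      using \<epsilon> by (subst c) (simp add: sum_distrib_left wint_sum wint_smult)
    also have "\<dots> \<le> (\<Sum>k<n. \<bar>c k\<bar> * (A * \<epsilon>\<^sup>2))"
    proof (rule sum_mono)
      fix k assume "k \<in> {..<n}"
      then have "\<bar>c k\<bar> * \<bar>wint \<alpha> \<epsilon> (p * herm k)\<bar> \<le> \<bar>c k\<bar> * (A * \<epsilon>\<^sup>2)"
        using A[of k \<epsilon>] \<epsilon> by (intro mult_left_mono) (auto simp: p_def)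
      then show "c k * wint \<alpha> \<epsilon> (p * herm k) \<le> \<bar>c k\<bar> * (A * \<epsilon>\<^sup>2)"
        by (metis abs_ge_self abs_mult order_trans)
    qed
    also have "\<dots> = A * \<epsilon>\<^sup>2 * T" by (simp add: T_def sum_distrib_left mult_ac)
    finally have upper: "wint \<alpha> \<epsilon> (d * d) \<le> A * \<epsilon>\<^sup>2 * T" .
    have lower: "B * T\<^sup>2 \<le> wint \<alpha> \<epsilon> (d * d)"
      unfolding c T_def using B(3) \<epsilon> by blast
    have "B * T \<le> A * \<epsilon>\<^sup>2"
    proof (cases "T = 0")
      case False
      have "(B * T) * T \<le> (A * \<epsilon>\<^sup>2) * T" using upper lower by (simp add: power2_eq_square mult_ac)
      then show ?thesis using False T0 by simp
    qed (use A0 in simp)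
    then have "T \<le> A / B * \<epsilon>\<^sup>2" using B(1) by (simp add: field_simps)
    then have "A * \<epsilon>\<^sup>2 * T \<le> A * \<epsilon>\<^sup>2 * (A / B * \<epsilon>\<^sup>2)"
      using A0 by (intro mult_left_mono) auto
    also have "\<dots> = A * (A / B) * \<epsilon> ^ 4" by (simp add: eval_nat_numeral)
    finally have "wint \<alpha> \<epsilon> (d * d) \<le> A * (A / B) * \<epsilon> ^ 4" using upper by simp
    moreover have "wint \<alpha> \<epsilon> (d * d) \<ge> 0" by (rule wint_square_nonneg)
    moreover have "\<bar>wint \<alpha> \<epsilon> (p * p) - N \<epsilon>\<bar> \<le> K * \<epsilon> ^ 4" using K \<epsilon> by (simp add: p_def)
    ultimately show ?thesis using pp unfolding distrib_right by linarith
  qed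
  moreover have "min 1 \<epsilon>0 > 0" using B(2) by simp
  ultimately show ?thesis unfolding N_def by blast
qed

subsection \<open>Asymptotics of the normalized constant\<close>

lemma pcompose_linear_inverse:
  fixes \<sigma> :: real
  assumes "\<sigma> > 0"
  shows "pcompose (pcompose r [:- \<sigma>, 1 / \<sigma>:]) [:\<sigma>\<^sup>2, \<sigma>:] = r"
  using assms by (simp add: fun_eq_iff poly_pcompose field_simps power2_eq_square flip: poly_eq_poly_eq_iff)

text \<open>The polynomial r is carried back by the inverse affine map and expanded in the
  \<open>P k\<close> with k < n; each term vanishes because the prefactor linking
  \<open>wint\<close> to the Laguerre integral is nonzero.\<close>

lemma laguerre_orthogonal_wint:
  assumes P: "monic_orthogonal_polys \<alpha> (\<sigma> ^ 4) P" and \<sigma>: "\<sigma> \<ge> 1"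
    and r: "\<And>i. i \<ge> n \<Longrightarrow> coeff r i = 0"
  shows "wint \<alpha> (1 / \<sigma>) (pcompose (P n) [:\<sigma>\<^sup>2, \<sigma>:] * r) = 0"
proof -
  have \<sigma>0: "\<sigma> > 0" "0 < 1 / \<sigma>" "1 / \<sigma> \<le> 1" using \<sigma> by auto
  define r' where "r' = pcompose r [:- \<sigma>, 1 / \<sigma>:]"
  have "coeff r' i = 0" if "i \<ge> n" for i
  proof (cases "r = 0")
    case False
    then have "degree r < n" using r[of "degree r"] by (metis leading_coeff_0_iff not_le)
    moreover have "degree r' = degree r" using \<sigma>0 by (simp add: r'_def degree_pcompose)
    ultimately show ?thesis using that by (intro coeff_eq_0) simp
  qed (simp add: r'_def)
  then obtain c where c: "r' = (\<Sum>k<n. smult (c k) (P k))"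
    using monic_basis_expansion[of P n r'] P unfolding monic_orthogonal_polys_def by blast
  have 0: "wint \<alpha> (1 / \<sigma>) (pcompose (P n) [:\<sigma>\<^sup>2, \<sigma>:] * pcompose (P k) [:\<sigma>\<^sup>2, \<sigma>:]) = 0" if "k < n" for k
  proof -
    have "(LINT x:{0<..}|lborel. poly (P n * P k) x * laguerre_weight \<alpha> (\<sigma> ^ 4) x) = 0"
      using P that unfolding monic_orthogonal_polys_def by simp
    then have "\<sigma> powr (2 * \<alpha> + 1) * exp (- 2 * \<sigma>\<^sup>2) * wint \<alpha> (1 / \<sigma>) (pcompose (P n * P k) [:\<sigma>\<^sup>2, \<sigma>:]) = 0"
      unfolding laguerre_integral_eq_wint(2)[OF \<sigma>] .
    then show ?thesis using \<sigma>0 by (simp add: pcompose_mult)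
  qed
  have "r = pcompose r' [:\<sigma>\<^sup>2, \<sigma>:]"
    unfolding r'_def by (rule pcompose_linear_inverse[OF \<sigma>0(1), symmetric])
  also have "\<dots> = (\<Sum>k<n. smult (c k) (pcompose (P k) [:\<sigma>\<^sup>2, \<sigma>:]))"
    by (simp add: c pcompose_sum pcompose_smult)
  finally show ?thesis
    using \<sigma>0 0 by (simp add: sum_distrib_left wint_sum wint_smult)
qed

lemma monic_pcompose_linear:
  fixes p :: "real poly" and a :: real
  assumes "\<sigma> > 0" "degree p = n" "lead_coeff p = 1"
  defines "q \<equiv> smult (1 / \<sigma> ^ n) (pcompose p [:a, \<sigma>:])"
  shows "degree q = n \<and> lead_coeff q = 1"
proof -
  have "degree (pcompose p [:a, \<sigma>:]) = n" using assms by (simp add: degree_pcompose)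
  moreover have "lead_coeff (pcompose p [:a, \<sigma>:]) = \<sigma> ^ n"
    using assms(1-3) by (subst lead_coeff_comp) simp_all
  ultimately show ?thesis using assms(1) by (simp add: q_def)
qed

text \<open>In the centred variable the orthogonal polynomial has leading coefficient \<sigma>^n.
  Making it monic brings it under \<open>wint_monic_orthogonal_norm\<close> and puts \<sigma>^(2 n)
  into the prefactor.\<close>

lemma norm_const_expansion:
  assumes P: "\<And>t. t \<ge> 0 \<Longrightarrow> monic_orthogonal_polys \<alpha> t (P t)"
  shows "\<exists>C. \<forall>\<^sub>F \<sigma> in at_top. \<exists>W. \<bar>W - (1 + (2 * \<alpha> + 2 * real n + 1) * (2 * \<alpha> + 6 * real n + 3) / 16 / \<sigma>\<^sup>2)\<bar> \<le> C / \<sigma> ^ 4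
    \<and> norm_const \<alpha> (\<sigma> ^ 4) (P (\<sigma> ^ 4) n)
      = \<sigma> powr (2 * \<alpha> + 2 * real n + 1) * exp (- 2 * \<sigma>\<^sup>2) * herm_norm n * W"
proof -
  define c where "c = (2 * \<alpha> + 2 * real n + 1) * (2 * \<alpha> + 6 * real n + 3) / 16"
  define S where "S \<sigma> = pcompose (P (\<sigma> ^ 4) n) [:\<sigma>\<^sup>2, \<sigma>:]" for \<sigma> :: real
  define Q where "Q \<epsilon> = smult (1 / (1 / \<epsilon>) ^ n) (S (1 / \<epsilon>))" for \<epsilon> :: real
  have "\<exists>C. \<exists>\<epsilon>0>0. \<forall>\<epsilon>. 0 < \<epsilon> \<and> \<epsilon> \<le> \<epsilon>0 \<longrightarrow>
      \<bar>wint \<alpha> \<epsilon> (Q \<epsilon> * Q \<epsilon>) - herm_norm n * (1 + c * \<epsilon>\<^sup>2)\<bar> \<le> C * \<epsilon> ^ 4"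
    unfolding c_def
  proof (rule wint_monic_orthogonal_norm)
    fix \<epsilon> :: real assume \<epsilon>: "0 < \<epsilon>" "\<epsilon> \<le> 1"
    then have P': "monic_orthogonal_polys \<alpha> ((1 / \<epsilon>) ^ 4) (P ((1 / \<epsilon>) ^ 4))" by (intro P) simp
    then have "degree (P ((1 / \<epsilon>) ^ 4) n) = n" "lead_coeff (P ((1 / \<epsilon>) ^ 4) n) = 1"
      unfolding monic_orthogonal_polys_def by blast+
    then show "degree (Q \<epsilon>) = n \<and> lead_coeff (Q \<epsilon>) = 1"
      unfolding Q_def S_def using \<epsilon> by (intro monic_pcompose_linear) simp
    fix r :: "real poly" assume r: "\<And>i. i \<ge> n \<Longrightarrow> coeff r i = 0"
    have "wint \<alpha> (1 / (1 / \<epsilon>)) (S (1 / \<epsilon>) * r) = 0"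
      unfolding S_def by (rule laguerre_orthogonal_wint[OF P' _ r]) (use \<epsilon> in simp)
    then show "wint \<alpha> \<epsilon> (Q \<epsilon> * r) = 0"
      by (simp add: Q_def wint_smult)
  qed
  then obtain C \<epsilon>0 where C: "\<epsilon>0 > 0" "\<And>\<epsilon>. 0 < \<epsilon> \<and> \<epsilon> \<le> \<epsilon>0 \<Longrightarrow>
      \<bar>wint \<alpha> \<epsilon> (Q \<epsilon> * Q \<epsilon>) - herm_norm n * (1 + c * \<epsilon>\<^sup>2)\<bar> \<le> C * \<epsilon> ^ 4"
    by blast
  have "\<exists>W. \<bar>W - (1 + c / \<sigma>\<^sup>2)\<bar> \<le> (C / herm_norm n) / \<sigma> ^ 4 \<and> norm_const \<alpha> (\<sigma> ^ 4) (P (\<sigma> ^ 4) n)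
      = \<sigma> powr (2 * \<alpha> + 2 * real n + 1) * exp (- 2 * \<sigma>\<^sup>2) * herm_norm n * W"
    if \<sigma>: "\<sigma> \<ge> max 1 (1 / \<epsilon>0)" for \<sigma>
  proof (intro exI conjI)
    have \<sigma>0: "\<sigma> > 0" "\<sigma> \<ge> 1" using \<sigma> by auto
    define W where "W = wint \<alpha> (1 / \<sigma>) (Q (1 / \<sigma>) * Q (1 / \<sigma>)) / herm_norm n"
    have "1 / \<sigma> \<le> \<epsilon>0" using \<sigma> C(1) \<sigma>0 by (simp add: field_simps)
    then have "\<bar>wint \<alpha> (1 / \<sigma>) (Q (1 / \<sigma>) * Q (1 / \<sigma>)) - herm_norm n * (1 + c * (1 / \<sigma>)\<^sup>2)\<bar> \<le> C * (1 / \<sigma>) ^ 4"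
      using C(2)[of "1 / \<sigma>"] \<sigma>0 by simp
    then have "\<bar>herm_norm n * (W - (1 + c / \<sigma>\<^sup>2))\<bar> \<le> C / \<sigma> ^ 4"
      using herm_norm_pos[of n] by (simp add: W_def right_diff_distrib power_divide)
    then have "\<bar>W - (1 + c / \<sigma>\<^sup>2)\<bar> * herm_norm n \<le> C / \<sigma> ^ 4"
      using herm_norm_pos[of n] by (simp only: abs_mult abs_of_pos mult.commute)
    then have "\<bar>W - (1 + c / \<sigma>\<^sup>2)\<bar> \<le> (C / \<sigma> ^ 4) / herm_norm n"
      by (simp only: pos_le_divide_eq[OF herm_norm_pos])
    then show "\<bar>W - (1 + c / \<sigma>\<^sup>2)\<bar> \<le> (C / herm_norm n) / \<sigma> ^ 4"
      by (simp only: divide_divide_eq_left mult.commute)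
    have S: "S \<sigma> = smult (\<sigma> ^ n) (Q (1 / \<sigma>))"
      using \<sigma>0 by (simp add: Q_def)
    have "\<sigma> powr (real n + real n) = \<sigma> ^ n * \<sigma> ^ n"
      unfolding powr_add using \<sigma>0 by (simp add: powr_realpow)
    then have "wint \<alpha> (1 / \<sigma>) (S \<sigma> * S \<sigma>) = \<sigma> powr (2 * real n) * (herm_norm n * W)"
      unfolding S using herm_norm_pos[of n] by (simp add: wint_smult W_def)
    moreover have "norm_const \<alpha> (\<sigma> ^ 4) (P (\<sigma> ^ 4) n)
        = \<sigma> powr (2 * \<alpha> + 1) * exp (- 2 * \<sigma>\<^sup>2) * wint \<alpha> (1 / \<sigma>) (S \<sigma> * S \<sigma>)"
      using laguerre_integral_eq_wint(2)[OF \<sigma>0(2), of "P (\<sigma> ^ 4) n * P (\<sigma> ^ 4) n" \<alpha>]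
      by (simp add: norm_const_def power2_eq_square S_def pcompose_mult)
    ultimately show "norm_const \<alpha> (\<sigma> ^ 4) (P (\<sigma> ^ 4) n)
      = \<sigma> powr (2 * \<alpha> + 2 * real n + 1) * exp (- 2 * \<sigma>\<^sup>2) * herm_norm n * W"
      by (simp add: powr_add mult_ac)
  qed
  then have "\<forall>\<^sub>F \<sigma> in at_top. \<exists>W. \<bar>W - (1 + c / \<sigma>\<^sup>2)\<bar> \<le> (C / herm_norm n) / \<sigma> ^ 4
      \<and> norm_const \<alpha> (\<sigma> ^ 4) (P (\<sigma> ^ 4) n)
        = \<sigma> powr (2 * \<alpha> + 2 * real n + 1) * exp (- 2 * \<sigma>\<^sup>2) * herm_norm n * W"
    by (rule eventually_mono[OF eventually_ge_at_top])
  then show ?thesis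
    unfolding c_def by (rule exI[where x = "C / herm_norm n"])
qed

lemma ln_herm_norm: "ln (herm_norm n) = C_hat n"
proof -
  have "Gamma (real n + 1) = fact n" by (simp add: Gamma_fact[symmetric] add.commute)
  then show ?thesis
    by (simp add: herm_norm_def C_hat_def ln_mult ln_div ln_sqrt ln_realpow)
qed

text \<open>The smallness condition keeps W - 1 within 1/2 of zero, where ln (1 + y) - y is at most
  2 y^2 in absolute value; then W - 1 is replaced by c x at a cost of order x^2. It is used with x =
  1 / sqrt t.\<close>

lemma ln_one_plus_expansion:
  fixes c C x W :: real
  assumes x: "0 \<le> x" "x \<le> 1" "(\<bar>c\<bar> + \<bar>C\<bar>) * x \<le> 1 / 2" and W: "\<bar>W - (1 + c * x)\<bar> \<le> C * x\<^sup>2"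
  shows "W > 0" "\<bar>ln W - c * x\<bar> \<le> (2 * (\<bar>c\<bar> + \<bar>C\<bar>)\<^sup>2 + \<bar>C\<bar>) * x\<^sup>2"
proof -
  have "C * x\<^sup>2 \<le> \<bar>C\<bar> * x"
    using x by (intro mult_mono) (auto simp: power2_eq_square mult_left_le)
  moreover have "\<bar>c * x\<bar> = \<bar>c\<bar> * x" using x by (simp add: abs_mult)
  ultimately have y: "\<bar>W - 1\<bar> \<le> (\<bar>c\<bar> + \<bar>C\<bar>) * x"
    using W unfolding distrib_right by linarith
  then have half: "\<bar>W - 1\<bar> \<le> 1 / 2" using x(3) by linarith
  then show "W > 0" by linarith
  have "\<bar>ln (1 + (W - 1)) - (W - 1)\<bar> \<le> 2 * (W - 1)\<^sup>2"
    using half by (rule abs_ln_one_plus_x_minus_x_bound)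
  also have "(W - 1)\<^sup>2 \<le> ((\<bar>c\<bar> + \<bar>C\<bar>) * x)\<^sup>2"
    using y by (simp add: abs_le_square_iff[symmetric])
  finally have "\<bar>ln W - (W - 1)\<bar> \<le> 2 * (\<bar>c\<bar> + \<bar>C\<bar>)\<^sup>2 * x\<^sup>2"
    by (simp add: power_mult_distrib)
  moreover have "C * x\<^sup>2 \<le> \<bar>C\<bar> * x\<^sup>2" by (rule mult_right_mono) auto
  ultimately show "\<bar>ln W - c * x\<bar> \<le> (2 * (\<bar>c\<bar> + \<bar>C\<bar>)\<^sup>2 + \<bar>C\<bar>) * x\<^sup>2"
    using W unfolding distrib_right by linarith
qed

theorem theorem5p5:
  fixes \<alpha> :: real and n :: nat and P :: "real \<Rightarrow> nat \<Rightarrow> real poly"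
  assumes "\<alpha> > -1" and "n \<ge> 1"
    and "\<And>t. t \<ge> 0 \<Longrightarrow> monic_orthogonal_polys \<alpha> t (P t)"
  shows "(\<lambda>t. ln (norm_const \<alpha> t (P t n))
            - (- 2 * sqrt t
               + (2 * \<alpha> + 2 * real n + 1) / 4 * ln t
               + C_hat n
               + (2 * \<alpha> + 2 * real n + 1) * (2 * \<alpha> + 6 * real n + 3) / (16 * sqrt t)))
         \<in> O[at_top](\<lambda>t. 1 / t)"
proof -
  define c where "c = (2 * \<alpha> + 2 * real n + 1) * (2 * \<alpha> + 6 * real n + 3) / 16"
  obtain C where C: "\<forall>\<^sub>F \<sigma> in at_top. \<exists>W. \<bar>W - (1 + c / \<sigma>\<^sup>2)\<bar> \<le> C / \<sigma> ^ 4
    \<and> norm_const \<alpha> (\<sigma> ^ 4) (P (\<sigma> ^ 4) n)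
      = \<sigma> powr (2 * \<alpha> + 2 * real n + 1) * exp (- 2 * \<sigma>\<^sup>2) * herm_norm n * W"
    using norm_const_expansion[OF assms(3), of n] unfolding c_def by blast
  have "filterlim (\<lambda>t. sqrt (sqrt t)) at_top at_top"
    by (intro filterlim_compose[OF sqrt_at_top] sqrt_at_top)
  \<comment> \<open>Here \<sigma> is the fourth root of t. The second entry of the maximum ensures
    that sqrt t is at least twice the sum of the absolute values of c and C, which is the smallness
    condition of \<open>ln_one_plus_expansion\<close>.\<close>
  from eventually_compose_filterlim[OF C this] eventually_ge_at_top[of "max 1 ((2 * (\<bar>c\<bar> + \<bar>C\<bar>))\<^sup>2)"]
  have "\<forall>\<^sub>F t in at_top. norm (ln (norm_const \<alpha> t (P t n))
            - (- 2 * sqrt t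
               + (2 * \<alpha> + 2 * real n + 1) / 4 * ln t
               + C_hat n
               + (2 * \<alpha> + 2 * real n + 1) * (2 * \<alpha> + 6 * real n + 3) / (16 * sqrt t)))
        \<le> (2 * (\<bar>c\<bar> + \<bar>C\<bar>)\<^sup>2 + \<bar>C\<bar>) * norm (1 / t)"
  proof eventually_elim
      case (elim t)
      then have t: "t \<ge> 1" "t > 0" by auto
      have s4: "sqrt (sqrt t) ^ 4 = t"
        using t power_mult[of "sqrt (sqrt t)" 2 2] by simp
      have s2: "(sqrt (sqrt t))\<^sup>2 = sqrt t" using t by simp
      have "2 * (\<bar>c\<bar> + \<bar>C\<bar>) \<le> sqrt t"
        using elim by (intro real_le_rsqrt) simp
      then have small: "(\<bar>c\<bar> + \<bar>C\<bar>) * (1 / sqrt t) \<le> 1 / 2" using t by (simp add: field_simps)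
      have x2: "(1 / sqrt t)\<^sup>2 = 1 / t" using t by (simp add: power_divide)
      obtain W where W: "\<bar>W - (1 + c / sqrt t)\<bar> \<le> C / t"
        and h: "norm_const \<alpha> t (P t n)
          = sqrt (sqrt t) powr (2 * \<alpha> + 2 * real n + 1) * exp (- 2 * sqrt t) * herm_norm n * W"
        using elim(1) unfolding s4 s2 by blast
      have W0: "W > 0" and lnW: "\<bar>ln W - c * (1 / sqrt t)\<bar> \<le> (2 * (\<bar>c\<bar> + \<bar>C\<bar>)\<^sup>2 + \<bar>C\<bar>) * (1 / sqrt t)\<^sup>2"
        using ln_one_plus_expansion[OF _ _ small, of W] W t unfolding x2 by simp_all
      have "ln (sqrt (sqrt t)) = ln t / 4" using t by (simp add: ln_sqrt)
      then have "ln (norm_const \<alpha> t (P t n))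
          = (2 * \<alpha> + 2 * real n + 1) / 4 * ln t - 2 * sqrt t + C_hat n + ln W"
        unfolding h using t W0 herm_norm_pos[of n]
        by (simp add: ln_mult ln_powr ln_herm_norm)
      then show ?case
        using lnW t unfolding x2 by (simp add: c_def)
  qed
  then show ?thesis by (rule bigoI)
qed

end
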